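(* Let $K$ be a multi-quadratic number field containing $\mathbb{Q}(\sqrt{-1})$, and let $K_{(8)} = K \cap \mathbb{Q}(\zeta_8)$. Then $J_1(4,8)(K)_{\mathrm{tors}} = J_1(4,8)(K_{(8)})$, and $$J_1(4,8)(K)_{\mathrm{tors}} \cong \begin{cases} \mathbb{Z}/2 \times \mathbb{Z}/4 & \text{if } K_{(8)} = \mathbb{Q}(\sqrt{-1}),\\ \mathbb{Z}/4 \times \mathbb{Z}/4 & \text{if } K_{(8)} = \mathbb{Q}(\sqrt{-1},\sqrt{2}).\end{cases}$$
   Context: A multi-quadratic number field is a number field which is a compositum of quadratic number fields. For positive integers $M,N$, $X_1(M,MN)$ is the modular curve (coarse moduli space) attached to the level structure $\Gamma_1(M,MN) = \{\begin{pmatrix}1&b\\0&d\end{pmatrix} \in \mathrm{GL}_2(\mathbb{Z}/MN) : b \equiv 0,\ d\equiv 1 \bmod M\}$; it is defined over $\mathbb{Q}(\zeta_M)$, and $J_1(M,MN)$ denotes its Jacobian. Here $X_1(4,8)$ is defined over $\mathbb{Q}(\sqrt{-1}) = \mathbb{Q}(\zeta_4)$; it is the base change of the elliptic curve with Cremona label 32a2. $\zeta_N$ is a primitive $N$-th root of unity. *)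

theory Defs
  imports
    "HOL-Analysis.Analysis"
    "HOL-Algebra.Algebra"
    "HOL-Algebra.Algebraic_Closure_Type"
begin

section \<open>Number fields inside the complex numbers\<close>

text \<open>
  Number fields are taken as subfields of the complex numbers, so that intersections and
  composita are literal.  \<^term>\<open>generate_field complex_field S\<close> is the smallest subfield
  containing \<^term>\<open>S\<close>, i.e. the field \<open>\<rat>(S)\<close>.
\<close>

abbreviation complex_field :: "complex ring" where
  "complex_field \<equiv> ring_of_type_algebra"

definition number_field :: "complex set \<Rightarrow> bool" where
  "number_field K \<longleftrightarrow>
     subfield K complex_field \<and> ring.finite_dimension complex_field \<rat> K"

definition quadratic_number_field :: "complex set \<Rightarrow> bool" where
  "quadratic_number_field K \<longleftrightarrow>
     subfield K complex_field \<and> ring.dimension complex_field 2 \<rat> K"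

definition compositum :: "complex set set \<Rightarrow> complex set" where
  "compositum F = generate_field complex_field (\<Union>F)"

definition multi_quadratic_number_field :: "complex set \<Rightarrow> bool" where
  "multi_quadratic_number_field K \<longleftrightarrow>
     number_field K \<and> (\<exists>F. (\<forall>L\<in>F. quadratic_number_field L) \<and> K = compositum F)"

definition adjoin_rat :: "complex set \<Rightarrow> complex set"  (\<open>\<rat>'(_')\<close>) where
  "\<rat>(S) = generate_field complex_field S"

definition zeta :: "nat \<Rightarrow> complex" where
  "zeta n = cis (2 * pi / real n)"


section \<open>Weierstrass curves and their groups of points\<close>

text \<open>
  \<^term>\<open>Weierstrass a1 a2 a3 a4 a6\<close> is the curve
  \<open>y\<^sup>2 + a1 x y + a3 y = x\<^sup>3 + a2 x\<^sup>2 + a4 x + a6\<close>.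
\<close>

datatype 'a weierstrass_curve = Weierstrass 'a 'a 'a 'a 'a

datatype 'a curve_point = Infinity | Affine 'a 'a

fun discriminant :: "'a::field weierstrass_curve \<Rightarrow> 'a" where
  "discriminant (Weierstrass a1 a2 a3 a4 a6) =
     (let b2 = a1^2 + 4 * a2;
          b4 = 2 * a4 + a1 * a3;
          b6 = a3^2 + 4 * a6;
          b8 = a1^2 * a6 + 4 * a2 * a6 - a1 * a3 * a4 + a2 * a3^2 - a4^2
      in - (b2^2 * b8) - 8 * b4^3 - 27 * b6^2 + 9 * b2 * b4 * b6)"

fun on_curve :: "'a::field weierstrass_curve \<Rightarrow> 'a curve_point \<Rightarrow> bool" where
  "on_curve E Infinity \<longleftrightarrow> True"
| "on_curve (Weierstrass a1 a2 a3 a4 a6) (Affine x y) \<longleftrightarrow>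
     y^2 + a1 * x * y + a3 * y = x^3 + a2 * x^2 + a4 * x + a6"

fun coords_in :: "'a set \<Rightarrow> 'a curve_point \<Rightarrow> bool" where
  "coords_in K Infinity \<longleftrightarrow> True"
| "coords_in K (Affine x y) \<longleftrightarrow> x \<in> K \<and> y \<in> K"

text \<open>
  The chord-tangent law.  The first test says that the second point is the negative of the
  first; otherwise \<open>l\<close> is the slope of the chord, or of the tangent if the points coincide.
  It is a group law on the points of the curve when the discriminant is nonzero.
\<close>

fun point_add ::
  "'a::field weierstrass_curve \<Rightarrow> 'a curve_point \<Rightarrow> 'a curve_point \<Rightarrow> 'a curve_point"
where
  "point_add E Infinity Q = Q"
| "point_add E (Affine x y) Infinity = Affine x y"
| "point_add (Weierstrass a1 a2 a3 a4 a6) (Affine x1 y1) (Affine x2 y2) =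
     (if x1 = x2 \<and> y1 + y2 + a1 * x2 + a3 = 0 then Infinity
      else
        let l = (if x1 = x2
                 then (3 * x1^2 + 2 * a2 * x1 + a4 - a1 * y1) / (2 * y1 + a1 * x1 + a3)
                 else (y2 - y1) / (x2 - x1));
            m = y1 - l * x1;
            x3 = l^2 + a1 * l - a2 - x1 - x2
        in Affine x3 (- (l + a1) * x3 - m - a3))"

definition point_group ::
  "'a::field weierstrass_curve \<Rightarrow> 'a set \<Rightarrow> 'a curve_point monoid" where
  "point_group E K =
     \<lparr>carrier = {P. on_curve E P \<and> coords_in K P},
      monoid.mult = point_add E,
      one = Infinity\<rparr>"

definition torsion :: "('a, 'b) monoid_scheme \<Rightarrow> 'a set" where
  "torsion G = {x \<in> carrier G. \<exists>n::nat. n > 0 \<and> x [^]\<^bsub>G\<^esub> n = \<one>\<^bsub>G\<^esub>}"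

definition torsion_group :: "('a, 'b) monoid_scheme \<Rightarrow> ('a, 'b) monoid_scheme" where
  "torsion_group G = G\<lparr>carrier := torsion G\<rparr>"


section \<open>The modular Jacobian\<close>

text \<open>The curve with Cremona label 32a2, \<open>y\<^sup>2 = x\<^sup>3 - x\<close>.\<close>

definition cremona_32a2 :: "'a::field weierstrass_curve" where
  "cremona_32a2 = Weierstrass 0 0 0 (-1) 0"

lemma discriminant_cremona_32a2: "discriminant (cremona_32a2 :: complex weierstrass_curve) = 64"
  by (simp add: cremona_32a2_def Let_def)

text \<open>
  The modular curve \<open>X\<^sub>1(4,8)\<close> over \<open>\<rat>(\<i>)\<close> is the base change of 32a2; being an elliptic
  curve, it is its own Jacobian.  \<open>J1_4_8 K\<close> is the group of \<open>K\<close>-rational points of this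
  Jacobian, for a field \<open>K\<close> containing \<open>\<rat>(\<i>)\<close>.
\<close>

definition J1_4_8 :: "complex set \<Rightarrow> complex curve_point monoid" where
  "J1_4_8 K = point_group cremona_32a2 K"

end

theory Submission
  imports Defs "HOL-Computational_Algebra.Nth_Powers"
begin

text \<open>
  Let \<open>E\<close> be the curve \<open>y\<^sup>2 = x\<^sup>3 - x\<close>. If \<open>\<sigma>\<close> generates the Galois group of \<open>L(\<surd>d)\<close> over \<open>L\<close>, then
  \<open>2 P = (P + \<sigma> P) + (P - \<sigma> P)\<close> splits twice a point over \<open>L(\<surd>d)\<close> into an \<open>L\<close>-point of \<open>E\<close> and an
  \<open>L\<close>-point of the twist of \<open>E\<close> by \<open>d\<close>. Descending a tower of quadratic extensions in this way
  reduces everything to rational points on twists \<open>e y\<^sup>2 = x\<^sup>3 - x\<close>. There a torsion point is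
  2-torsion, because numerators grow along doubling orbits; hence all torsion over a
  multi-quadratic field \<open>K\<close> is 2-power torsion. A point of order 8 would make \<open>2\<close> a fourth power
  or one of \<open>1 + \<i>\<close>, \<open>1 - \<i>\<close> a square in \<open>K\<close>, which Kummer theory excludes, so the torsion lies in
  \<open>E[4]\<close>, which is defined over \<open>\<rat>(\<zeta>\<^sub>8)\<close>. Conversely, for \<open>e = \<plusminus>1, \<plusminus>2\<close> Fermat's descent
  shows that the twists have no further rational points at all, so every point over
  \<open>\<rat>(\<zeta>\<^sub>8)\<close> is torsion.
\<close>

section \<open>The group law on $y^2 = x^3 - x$\<close>

text \<open>A twist is never treated as a separate curve: \<open>e v^2 = x^3 - x\<close> is realised
  on the one complex curve by the points \<open>(x, s v)\<close> with \<open>s^2 = e\<close>. A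
  single group law then serves every field and every twist, at the price of proving its
  associativity from the chord-tangent formulas. Each splitting step sees only the double of a
  point, so descending a tower of unknown height shows that torsion has 2-power order without
  bounding the exponent. The bound has another source: the abscissa \<open>t\<close> of a doubled
  point makes \<open>t\<close>, \<open>t - 1\<close> and \<open>t + 1\<close> squares, while the
  halves of \<open>(0, 0)\<close>, \<open>(1, 0)\<close>, \<open>(-1, 0)\<close> satisfy
  \<open>t^2 = -1\<close>, \<open>(t - 1)^2 = 2\<close>, \<open>(t + 1)^2 = 2\<close>. Combining the
  two produces the obstructions to order 8. The numbers -1 and 2 are the square classes that
  generate Q(zeta_8), so exactly the twists by 1, -1, 2, -2 arise when points over that field are
  split.\<close>

definition ell :: "complex curve_point set" where
  "ell = {P. on_curve cremona_32a2 P}"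

abbreviation ell_add :: "complex curve_point \<Rightarrow> complex curve_point \<Rightarrow> complex curve_point"
    (infixl \<open>\<boxplus>\<close> 65) where
  "P \<boxplus> Q \<equiv> point_add cremona_32a2 P Q"

fun ell_neg :: "complex curve_point \<Rightarrow> complex curve_point" (\<open>\<boxminus> _\<close> [81] 80) where
  "\<boxminus> Infinity = Infinity"
| "\<boxminus> (Affine x y) = Affine x (- y)"

text \<open>The line \<open>y = l x + m\<close> meets the curve at the abscissae \<open>a\<close>, \<open>b\<close>, \<open>c\<close>, with
  multiplicities.\<close>

definition line_meets :: "complex \<Rightarrow> complex \<Rightarrow> complex \<Rightarrow> complex \<Rightarrow> complex \<Rightarrow> bool" where
  "line_meets l m a b c \<longleftrightarrow>
     a + b + c = l\<^sup>2 \<and> a * b + b * c + a * c = - 1 - 2 * l * m \<and> a * b * c = m\<^sup>2"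

lemma Infinity_in_ell [simp]: "Infinity \<in> ell"
  by (simp add: ell_def)

lemma Affine_in_ell: "Affine x y \<in> ell \<longleftrightarrow> y\<^sup>2 = x ^ 3 - x"
  by (simp add: ell_def cremona_32a2_def)

lemma add_Infinity_right [simp]: "P \<boxplus> Infinity = P"
  by (cases P) (auto simp: cremona_32a2_def)

lemma add_Affine:
  "Affine x1 y1 \<boxplus> Affine x2 y2 =
     (if x1 = x2 \<and> y1 + y2 = 0 then Infinity
      else let l = (if x1 = x2 then (3 * x1\<^sup>2 - 1) / (2 * y1) else (y2 - y1) / (x2 - x1))
           in Affine (l\<^sup>2 - x1 - x2) (- (l * (l\<^sup>2 - x1 - x2) + (y1 - l * x1))))"
  by (simp add: cremona_32a2_def Let_def algebra_simps)

lemma neg_neg [simp]: "\<boxminus> (\<boxminus> P) = P"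
  by (cases P) auto

lemma neg_in_ell [simp]: "\<boxminus> P \<in> ell \<longleftrightarrow> P \<in> ell"
  by (cases P) (auto simp: Affine_in_ell)

lemma add_neg [simp]: "P \<boxplus> \<boxminus> P = Infinity"
  by (cases P) (auto simp: add_Affine)

lemma add_eq_Infinity_iff: "P \<boxplus> Q = Infinity \<longleftrightarrow> Q = \<boxminus> P"
  by (cases P; cases Q) (auto simp: add_Affine Let_def add_eq_0_iff)

lemma ell_eq_or_neg:
  assumes "Affine x y1 \<in> ell" "Affine x y2 \<in> ell"
  shows "y2 = y1 \<or> y2 = - y1"
  using assms unfolding Affine_in_ell by (metis power2_eq_iff)

lemma line_meets_poly:
  assumes "line_meets l m a b c"
  shows "x ^ 3 - x - (l * x + m)\<^sup>2 = (x - a) * (x - b) * (x - c)"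
  using assms unfolding line_meets_def by Groebner_Basis.algebra

lemma line_meets_commute:
  assumes "line_meets l m a b c"
  shows "line_meets l m b a c"
  using assms unfolding line_meets_def by (auto simp: algebra_simps)

lemma add_affine_line:
  assumes "Affine x1 y1 \<in> ell" "Affine x2 y2 \<in> ell" "Affine x2 y2 \<noteq> \<boxminus> (Affine x1 y1)"
  obtains l m w where "y1 = l * x1 + m" "y2 = l * x2 + m"
    "Affine x1 y1 \<boxplus> Affine x2 y2 = Affine w (- (l * w + m))" "line_meets l m x1 x2 w"
proof -
  define l where "l = (if x1 = x2 then (3 * x1\<^sup>2 - 1) / (2 * y1) else (y2 - y1) / (x2 - x1))"
  define m where "m = y1 - l * x1"
  define w where "w = l\<^sup>2 - x1 - x2"
  have not_opp: "\<not> (x1 = x2 \<and> y1 + y2 = 0)"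
    using assms(3) by (auto simp: add_eq_0_iff)
  have c1: "y1\<^sup>2 = x1 ^ 3 - x1" and c2: "y2\<^sup>2 = x2 ^ 3 - x2"
    using assms(1,2) by (auto simp: Affine_in_ell)
  have on1: "y1 = l * x1 + m" by (simp add: m_def)
  \<comment> \<open>The slope relation is the difference of the two curve equations divided by
    \<open>x2 - x1\<close>. It stays true for a tangent, so Vieta's relations below need no case
    distinction.\<close>
  have "y2 = l * x2 + m \<and> l * (y1 + y2) = x1\<^sup>2 + x1 * x2 + x2\<^sup>2 - 1"
  proof (cases "x1 = x2")
    case True
    then have "y2 = y1" using not_opp ell_eq_or_neg assms(1,2) by force
    moreover from this have "y1 \<noteq> 0" using not_opp True by auto
    ultimately show ?thesis
      using True by (simp add: l_def m_def power2_eq_square)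
  next
    case False
    have sl: "l * (x2 - x1) = y2 - y1" using False by (simp add: l_def)
    then have "y2 = l * x2 + m" by (simp add: m_def algebra_simps)
    moreover have "(x2 - x1) * (l * (y1 + y2) - (x1\<^sup>2 + x1 * x2 + x2\<^sup>2 - 1)) = 0"
      using sl c1 c2 by Groebner_Basis.algebra
    ultimately show ?thesis using False by simp
  qed
  then have on2: "y2 = l * x2 + m" and K: "l * (y1 + y2) = x1\<^sup>2 + x1 * x2 + x2\<^sup>2 - 1" by auto
  have "line_meets l m x1 x2 w"
    unfolding line_meets_def
  proof (intro conjI)
    show "x1 + x2 + w = l\<^sup>2" by (simp add: w_def)
    show "x1 * x2 + x2 * w + x1 * w = - 1 - 2 * l * m"
      using K w_def on1 on2 by Groebner_Basis.algebra
    then show "x1 * x2 * w = m\<^sup>2"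
      using on1 c1 w_def by Groebner_Basis.algebra
  qed
  moreover have "Affine x1 y1 \<boxplus> Affine x2 y2 = Affine w (- (l * w + m))"
    using not_opp by (simp add: add_Affine Let_def l_def m_def w_def)
  ultimately show ?thesis using that on1 on2 by blast
qed

text \<open>Converse of \<open>add_affine_line\<close>: exhibiting a line and its three abscissae is
  enough to compute a sum. A double root forces the tangent slope, so the slope used by the addition
  law is recovered in both cases.\<close>

lemma add_affine_lineI:
  assumes "line_meets l m x1 x2 w" "\<not> (x1 = x2 \<and> (l * x1 + m) + (l * x2 + m) = 0)"
  shows "Affine x1 (l * x1 + m) \<boxplus> Affine x2 (l * x2 + m) = Affine w (- (l * w + m))"
proof -
  have w: "w = l\<^sup>2 - x1 - x2"
    using assms(1) by (auto simp: line_meets_def algebra_simps)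
  show ?thesis
  proof (cases "x1 = x2")
    case True
    then have nz: "l * x1 + m \<noteq> 0" using assms(2) by (metis add_0)
    have "l * (2 * (l * x1 + m)) = 3 * x1\<^sup>2 - 1"
      using assms(1) True w unfolding line_meets_def by Groebner_Basis.algebra
    then have "(3 * x1\<^sup>2 - 1) / (2 * (l * x1 + m)) = l"
      using nz by (metis nonzero_divide_eq_eq mult_eq_0_iff zero_neq_numeral)
    then show ?thesis using assms(2) True w by (simp add: add_Affine Let_def)
  next
    case False
    then have "(l * x2 + m - (l * x1 + m)) / (x2 - x1) = l"
      by (simp add: divide_eq_eq algebra_simps)
    then show ?thesis using False w by (simp add: add_Affine Let_def)
  qed
qed

lemma line_third_in_ell:
  assumes "line_meets l m a b c"
  shows "Affine c (l * c + m) \<in> ell" "Affine c (- (l * c + m)) \<in> ell"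
  using line_meets_poly[OF assms, of c]
  by (simp_all only: Affine_in_ell power2_minus) simp_all

lemma add_in_ell [simp]:
  assumes "P \<in> ell" "Q \<in> ell"
  shows "P \<boxplus> Q \<in> ell"
proof (cases "P = Infinity \<or> Q = Infinity \<or> Q = \<boxminus> P")
  case True
  then show ?thesis using assms by auto
next
  case False
  then obtain x1 y1 x2 y2 where eq: "P = Affine x1 y1" "Q = Affine x2 y2"
    by (metis curve_point.exhaust)
  obtain l m w where "P \<boxplus> Q = Affine w (- (l * w + m))" "line_meets l m x1 x2 w"
    using add_affine_line assms False unfolding eq by blast
  then show ?thesis using line_third_in_ell by simp
qed

lemma add_commute_ell:
  assumes "P \<in> ell" "Q \<in> ell"
  shows "P \<boxplus> Q = Q \<boxplus> P"
proof (cases "P = Infinity \<or> Q = Infinity \<or> Q = \<boxminus> P")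
  case True
  then show ?thesis using add_neg[of "\<boxminus> P"] by auto
next
  case False
  then obtain x1 y1 x2 y2 where eq: "P = Affine x1 y1" "Q = Affine x2 y2"
    by (metis curve_point.exhaust)
  obtain l m w where l: "y1 = l * x1 + m" "y2 = l * x2 + m"
    "P \<boxplus> Q = Affine w (- (l * w + m))" "line_meets l m x1 x2 w"
    using add_affine_line assms False unfolding eq by blast
  have "\<not> (x2 = x1 \<and> (l * x2 + m) + (l * x1 + m) = 0)"
    using False unfolding eq l(1,2) by (auto simp: add_eq_0_iff)
  from add_affine_lineI[OF line_meets_commute[OF l(4)] this]
  show ?thesis using l eq by simp
qed

lemma neg_add: "\<boxminus> (P \<boxplus> Q) = \<boxminus> P \<boxplus> \<boxminus> Q"
proof (cases P; cases Q)
  fix x1 y1 x2 y2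
  assume eq: "P = Affine x1 y1" "Q = Affine x2 y2"
  have 1: "(3 * x1\<^sup>2 - 1) / (2 * - y1) = - ((3 * x1\<^sup>2 - 1) / (2 * y1))" by simp
  have 2: "(- y2 - - y1) / (x2 - x1) = - ((y2 - y1) / (x2 - x1))"
    by (simp add: minus_divide_left)
  have 3: "- y1 + - y2 = 0 \<longleftrightarrow> y1 + y2 = 0" by (metis add.inverse_neutral minus_add_distrib neg_equal_iff_equal)
  show ?thesis
    unfolding eq ell_neg.simps add_Affine 1 2 3 Let_def
    by (simp add: algebra_simps)
qed auto

text \<open>Adding a point and subtracting it again uses the same line twice; the only degenerate
  position is \<open>A \<boxplus> T = T\<close>, which is excluded by smoothness.\<close>

lemma add_diff_cancel_ell:
  assumes "A \<in> ell" "T \<in> ell"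
  shows "(A \<boxplus> T) \<boxplus> \<boxminus> T = A"
proof (cases "A = Infinity \<or> T = Infinity \<or> T = \<boxminus> A")
  case True
  then show ?thesis using add_neg by auto
next
  case False
  then obtain x1 y1 x2 y2 where eq: "A = Affine x1 y1" "T = Affine x2 y2"
    by (metis curve_point.exhaust)
  obtain l m w where l: "y1 = l * x1 + m" "y2 = l * x2 + m"
    "A \<boxplus> T = Affine w (- (l * w + m))" "line_meets l m x1 x2 w"
    using add_affine_line assms False unfolding eq by blast
  have l': "line_meets (- l) (- m) w x2 x1"
    using l(4) by (auto simp: line_meets_def algebra_simps)
  have "\<not> (w = x2 \<and> (- l * w + - m) + (- l * x2 + - m) = 0)"
  proof
    assume *: "w = x2 \<and> (- l * w + - m) + (- l * x2 + - m) = 0"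
    then have "2 * (l * x2 + m) = 0" by (auto simp: algebra_simps add_eq_0_iff)
    then have "y2 = 0" unfolding l(2) by (metis mult_eq_0_iff zero_neq_numeral)
    moreover have "y2\<^sup>2 = x2 ^ 3 - x2" using assms(2) eq by (simp add: Affine_in_ell)
    moreover have "l * (2 * y2) = 3 * x2\<^sup>2 - 1"
    proof -
      have "x1 + x2 + x2 = l\<^sup>2" "x1 * x2 + x2 * x2 + x1 * x2 = - 1 - 2 * l * m"
        using * l(4) by (auto simp: line_meets_def)
      then have "3 * x2\<^sup>2 - 1 = 2 * x2 * l\<^sup>2 + 2 * l * m"
        by Groebner_Basis.algebra
      then show ?thesis unfolding l(2) by (simp add: algebra_simps power2_eq_square)
    qed
    ultimately have "(1::complex) = 0" by Groebner_Basis.algebra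
    then show False by simp
  qed
  from add_affine_lineI[OF l' this] show ?thesis using l eq by (simp add: algebra_simps)
qed

lemma add_right_cancel_ell:
  assumes "A \<in> ell" "B \<in> ell" "T \<in> ell" "A \<boxplus> T = B \<boxplus> T"
  shows "A = B"
  using add_diff_cancel_ell assms by metis

text \<open>The product of the lines through \<open>P, Q\<close> and through \<open>P \<boxplus> Q, T\<close>, divided by the vertical
  line through \<open>P \<boxplus> Q\<close>, is a function \<open>x\<^sup>2 + \<beta> x + \<gamma> y + \<alpha>\<close>
  vanishing at \<open>P\<close>, \<open>Q\<close>, \<open>T\<close> and
  \<open>\<boxminus> ((P \<boxplus> Q) \<boxplus> T)\<close>. Such a function is unique up to scaling, whence associativity.\<close>

lemma two_lines_function:
  assumes "line_meets l m u v w" "line_meets k n w t s" "k * w + n = - (l * w + m)"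
  obtains \<alpha> \<beta> \<gamma> where
    "\<gamma> = - (k + l)" "s = \<gamma>\<^sup>2 - 2 * \<beta> - u - v - t"
    "\<And>x. x\<^sup>2 + \<gamma> * (l * x + m) + \<beta> * x + \<alpha> = (x - u) * (x - v)"
    "\<And>x. x\<^sup>2 + \<gamma> * (k * x + n) + \<beta> * x + \<alpha> = (x - t) * (x - s)"
    "\<And>x y. (x - w) * (x\<^sup>2 + \<gamma> * y + \<beta> * x + \<alpha>) =
        x ^ 3 - x - y\<^sup>2 + (y - l * x - m) * (y - k * x - n)"
proof -
  define \<gamma> where "\<gamma> = - (k + l)"
  define \<beta> where "\<beta> = k * l + w"
  define \<alpha> where "\<alpha> = l * n + k * m - 1 + w * \<beta>"
  note defs = \<gamma>_def \<beta>_def \<alpha>_def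
  note L = assms[unfolded line_meets_def]
  have 1: "s = \<gamma>\<^sup>2 - 2 * \<beta> - u - v - t"
    using L defs by Groebner_Basis.algebra
  have a: "\<gamma> * l + \<beta> = - (u + v)" "\<gamma> * m + \<alpha> = u * v"
    using L defs by Groebner_Basis.algebra+
  have b: "\<gamma> * k + \<beta> = - (t + s)" "\<gamma> * n + \<alpha> = t * s"
    using L defs by Groebner_Basis.algebra+
  have 2: "x\<^sup>2 + \<gamma> * (l * x + m) + \<beta> * x + \<alpha> = (x - u) * (x - v)" for x
    using a by Groebner_Basis.algebra
  have 3: "x\<^sup>2 + \<gamma> * (k * x + n) + \<beta> * x + \<alpha> = (x - t) * (x - s)" for x
    using b by Groebner_Basis.algebra
  have c: "- (w * \<alpha>) = m * n"
    using L defs by Groebner_Basis.algebra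
  have 4: "(x - w) * (x\<^sup>2 + \<gamma> * y + \<beta> * x + \<alpha>) =
        x ^ 3 - x - y\<^sup>2 + (y - l * x - m) * (y - k * x - n)" for x y
    using c defs assms(3) by Groebner_Basis.algebra
  show ?thesis using that[OF \<gamma>_def 1 2 3 4] .
qed

text \<open>Let \<open>f\<close> and \<open>f'\<close> be the functions attached to the two
  bracketings. They agree on the line through \<open>U\<close> and \<open>V\<close>, so
  \<open>f - f'\<close> is a multiple of that line; \<open>T\<close> is a common zero off the line,
  whence \<open>f = f'\<close>, and both sums are the negative of the fourth zero. The case
  \<open>U = V\<close> is allowed, which is why zeros are compared with multiplicity.\<close>

lemma generic_assoc_ell:
  assumes in_ell: "U \<in> ell" "V \<in> ell" "T \<in> ell"
    and fin: "U = Affine u yu" "V = Affine v yv" "T = Affine t yt"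
    and W: "U \<boxplus> V = Affine w yw" and W': "V \<boxplus> T = Affine w' yw'"
    and ne: "t \<noteq> u" "t \<noteq> v" "t \<noteq> w" "w' \<noteq> u" "w' \<noteq> v"
  shows "(U \<boxplus> V) \<boxplus> T = (V \<boxplus> T) \<boxplus> U"
proof -
  have "V \<noteq> \<boxminus> U" using W by auto
  then obtain l m where l: "yu = l * u + m" "yv = l * v + m" "yw = - (l * w + m)" "line_meets l m u v w"
    using add_affine_line[of u yu v yv] in_ell fin W by (metis curve_point.inject)
  have "U \<boxplus> V \<in> ell" "V \<boxplus> T \<in> ell" using in_ell by auto
  then have Win: "Affine w yw \<in> ell" "Affine w' yw' \<in> ell" using W W' by auto
  obtain k n s where k: "yw = k * w + n" "yt = k * t + n"
    "(U \<boxplus> V) \<boxplus> T = Affine s (- (k * s + n))" "line_meets k n w t s"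
    using add_affine_line[of w yw t yt] in_ell fin ne Win W by auto
  have "T \<noteq> \<boxminus> V" using W' by auto
  then obtain l' m' where l': "yv = l' * v + m'" "yt = l' * t + m'" "yw' = - (l' * w' + m')"
      "line_meets l' m' v t w'"
    using add_affine_line[of v yv t yt] in_ell fin W' by (metis curve_point.inject)
  obtain k' n' s' where k': "yw' = k' * w' + n'" "yu = k' * u + n'"
    "(V \<boxplus> T) \<boxplus> U = Affine s' (- (k' * s' + n'))" "line_meets k' n' w' u s'"
    using add_affine_line[of w' yw' u yu] in_ell fin ne Win W' by auto
  obtain \<alpha> \<beta> \<gamma> where f: "\<gamma> = - (k + l)" "s = \<gamma>\<^sup>2 - 2 * \<beta> - u - v - t"
    "\<And>x. x\<^sup>2 + \<gamma> * (l * x + m) + \<beta> * x + \<alpha> = (x - u) * (x - v)"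
    "\<And>x. x\<^sup>2 + \<gamma> * (k * x + n) + \<beta> * x + \<alpha> = (x - t) * (x - s)"
    using two_lines_function[OF l(4) k(4)] l(3) k(1) by metis
  obtain \<alpha>' \<beta>' \<gamma>' where f': "\<gamma>' = - (k' + l')" "s' = \<gamma>'\<^sup>2 - 2 * \<beta>' - v - t - u"
    "\<And>x. x\<^sup>2 + \<gamma>' * (l' * x + m') + \<beta>' * x + \<alpha>' = (x - v) * (x - t)"
    "\<And>x. x\<^sup>2 + \<gamma>' * (k' * x + n') + \<beta>' * x + \<alpha>' = (x - u) * (x - s')"
    "\<And>x y. (x - w') * (x\<^sup>2 + \<gamma>' * y + \<beta>' * x + \<alpha>') =
        x ^ 3 - x - y\<^sup>2 + (y - l' * x - m') * (y - k' * x - n')"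
    using two_lines_function[OF l'(4) k'(4)] l'(3) k'(1) by metis
  define c where "c = (l - l') * (l - k')"
  define p q where "p = \<gamma>' * l + \<beta>'" and "q = \<gamma>' * m + \<alpha>'"
  \<comment> \<open>On the line through \<open>U\<close> and \<open>V\<close>, the lines of slope
    \<open>l'\<close> (through \<open>V\<close>) and \<open>k'\<close> (through \<open>U\<close>)
    become multiples of \<open>x - v\<close> and \<open>x - u\<close>. Hence
    \<open>(x - u) * (x - v)\<close> splits off even when \<open>u = v\<close>.\<close>
  have eq: "(x - w') * (x\<^sup>2 + p * x + q) = (x - u) * (x - v) * (x - w + c)" for x
  proof -
    have m: "m = yv - l * v" "m' = yv - l' * v" "m = yu - l * u" "n' = yu - k' * u"
      using l(1,2) l'(1) k'(2) by (simp_all add: algebra_simps)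
    have "l * x + m - l' * x - m' = (l - l') * (x - v)"
      unfolding m(1,2) by (simp add: algebra_simps)
    moreover have "l * x + m - k' * x - n' = (l - k') * (x - u)"
      unfolding m(3,4) by (simp add: algebra_simps)
    moreover have "x\<^sup>2 + \<gamma>' * (l * x + m) + \<beta>' * x + \<alpha>' = x\<^sup>2 + p * x + q"
      by (simp add: p_def q_def algebra_simps)
    ultimately have "(x - w') * (x\<^sup>2 + p * x + q) =
        (x - u) * (x - v) * (x - w) + (l - l') * (x - v) * ((l - k') * (x - u))"
      using f'(5)[of x "l * x + m"] line_meets_poly[OF l(4), of x] by (simp only:)
    also have "\<dots> = (x - u) * (x - v) * (x - w + c)"
      by (simp add: c_def algebra_simps)
    finally show ?thesis .
  qed
  \<comment> \<open>As \<open>w'\<close> is neither \<open>u\<close> nor \<open>v\<close>, it has to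
    be the root of the third factor.\<close>
  have "(w' - u) * (w' - v) * (w' - w + c) = 0" using eq[of w'] by simp
  then have c: "w - c = w'" using ne by (simp add: add_eq_0_iff)
  have quad: "x\<^sup>2 + p * x + q = (x - u) * (x - v)" if "x \<noteq> w'" for x
  proof -
    have "x - w + c = x - w'" using c by (simp add: algebra_simps)
    then have "(x - w') * (x\<^sup>2 + p * x + q) = (x - w') * ((x - u) * (x - v))"
      using eq[of x] by simp
    then show ?thesis using that by simp
  qed
  have lin: "p * x + q = u * v - (u + v) * x" if "x \<noteq> w'" for x
    using quad[OF that] by (simp add: algebra_simps power2_eq_square)
  \<comment> \<open>The factor \<open>x - w'\<close> was cancelled pointwise, so coefficients are
    compared at two abscissae other than \<open>w'\<close>.\<close>
  have pq: "p = - (u + v)" "q = u * v"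
    using lin[of "w' + 1"] lin[of "w' + 2"] by (simp, Groebner_Basis.algebra)+
  have mid: "x\<^sup>2 + \<gamma>' * (l * x + m) + \<beta>' * x + \<alpha>' = (x - u) * (x - v)" for x
    using pq p_def q_def by Groebner_Basis.algebra
  have ft: "t\<^sup>2 + \<gamma> * yt + \<beta> * t + \<alpha> = 0" using f(4)[of t] k(2) by simp
  have ft': "t\<^sup>2 + \<gamma>' * yt + \<beta>' * t + \<alpha>' = 0" using f'(3)[of t] l'(2) by simp
  have "t ^ 3 - t - (l * t + m)\<^sup>2 \<noteq> 0" using line_meets_poly[OF l(4), of t] ne by simp
  then have off: "yt \<noteq> l * t + m" using in_ell(3) fin(3) by (auto simp: Affine_in_ell)
  have lin: "\<gamma> * l + \<beta> = \<gamma>' * l + \<beta>'" "\<gamma> * m + \<alpha> = \<gamma>' * m + \<alpha>'"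
    using f(3)[of 0] f(3)[of 1] mid[of 0] mid[of 1] by Groebner_Basis.algebra+
  have "(\<gamma> - \<gamma>') * (yt - l * t - m) = 0" using ft ft' lin by Groebner_Basis.algebra
  then have \<gamma>: "\<gamma>' = \<gamma>" using off by auto
  then have \<beta>: "\<beta>' = \<beta>" and \<alpha>: "\<alpha>' = \<alpha>" using lin by auto
  have s: "s' = s" using f(2) f'(2) \<gamma> \<beta> by simp
  \<comment> \<open>With \<open>\<gamma> = 0\<close> the function would depend on \<open>x\<close>
    alone and vanish only at \<open>u\<close> and \<open>v\<close>, yet \<open>T\<close> is a zero
    as well.\<close>
  have "\<gamma> \<noteq> 0"
  proof
    assume "\<gamma> = 0"
    then have "(t - u) * (t - v) = 0" using f(3)[of t] ft by simp
    then show False using ne by simp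
  qed
  moreover have "\<gamma> * (k * s + n) = \<gamma> * (k' * s + n')"
    using f(4)[of s] f'(4)[of s] \<gamma> \<beta> \<alpha> s by Groebner_Basis.algebra
  ultimately have "k * s + n = k' * s' + n'" using s by simp
  then show ?thesis using k(3) k'(3) s by simp
qed

section \<open>From associativity in general position to the group of complex points\<close>

lemma ell_abscissa_exists: "\<exists>y. Affine x y \<in> ell"
  by (rule exI[of _ "csqrt (x ^ 3 - x)"]) (simp add: Affine_in_ell)

fun abscissa :: "complex curve_point \<Rightarrow> complex" where
  "abscissa Infinity = 0"
| "abscissa (Affine x y) = x"

lemma ell_avoid_finite:
  assumes "finite B"
  obtains T where "T \<in> ell" "T \<notin> B" "\<boxminus> T \<notin> B"
proof -
  have "finite (abscissa ` B)" using assms by simp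
  then obtain x where x: "x \<notin> abscissa ` B" using ex_new_if_finite infinite_UNIV_char_0 by blast
  moreover obtain y where "Affine x y \<in> ell" using ell_abscissa_exists by blast
  moreover have "Affine x z \<notin> B" for z
    using x image_eqI[of x abscissa "Affine x z" B] by auto
  ultimately show ?thesis using that[of "Affine x y"] by auto
qed

lemma same_abscissa:
  assumes "Affine x y1 \<in> ell" "Affine x y2 \<in> ell"
  shows "Affine x y2 = Affine x y1 \<or> Affine x y2 = \<boxminus> (Affine x y1)"
  using ell_eq_or_neg[OF assms] by auto

text \<open>For fixed \<open>U\<close> and \<open>V\<close> each inequality required by general
  position excludes finitely many \<open>T\<close>; degenerate pairs reduce to cancellation.\<close>

lemma assoc_ell_cofinite:
  assumes U: "U \<in> ell" and V: "V \<in> ell"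
  shows "\<exists>B. finite B \<and> (\<forall>T\<in>ell. T \<notin> B \<longrightarrow> (U \<boxplus> V) \<boxplus> T = U \<boxplus> (V \<boxplus> T))"
proof (cases "U = Infinity \<or> V = Infinity \<or> V = \<boxminus> U")
  case True
  have "(U \<boxplus> V) \<boxplus> T = U \<boxplus> (V \<boxplus> T)" if "T \<in> ell" for T
    using True
  proof (elim disjE)
    assume V: "V = \<boxminus> U"
    have "(T \<boxplus> \<boxminus> U) \<boxplus> \<boxminus> (\<boxminus> U) = T" using that U add_diff_cancel_ell[of T "\<boxminus> U"] by simp
    then show ?thesis using V U that by (simp add: add_commute_ell)
  qed auto
  then show ?thesis by (intro exI[of _ "{}"]) auto
next
  case False
  then obtain u yu v yv w yw where fin: "U = Affine u yu" "V = Affine v yv"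
    and W: "U \<boxplus> V = Affine w yw"
    by (metis curve_point.exhaust add_eq_Infinity_iff)
  define N where "N = {Infinity, U, \<boxminus> U, V, \<boxminus> V, U \<boxplus> V, \<boxminus> (U \<boxplus> V)}"
  \<comment> \<open>\<open>N\<close> keeps \<open>T\<close> away from \<open>U\<close>,
    \<open>V\<close>, \<open>U \<boxplus> V\<close> and their negatives; the translates by
    \<open>\<boxminus> V\<close> keep \<open>V \<boxplus> T\<close> away from \<open>U\<close>,
    \<open>V\<close> and their negatives.\<close>
  define B where "B = N \<union> (\<lambda>P. P \<boxplus> \<boxminus> V) ` {U, \<boxminus> U, V, \<boxminus> V}"
  have "(U \<boxplus> V) \<boxplus> T = U \<boxplus> (V \<boxplus> T)" if T: "T \<in> ell" "T \<notin> B" for T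
  proof -
    obtain t yt where t: "T = Affine t yt"
      using T by (cases T) (auto simp: B_def N_def)
    have "T \<noteq> \<boxminus> V" using T by (auto simp: B_def N_def)
    then obtain w' yw' where W': "V \<boxplus> T = Affine w' yw'"
      by (metis curve_point.exhaust add_eq_Infinity_iff)
    have sums: "U \<boxplus> V \<in> ell" "V \<boxplus> T \<in> ell" using U V T by auto
    have x_ne: "x \<noteq> z" if "A \<in> ell" "Z \<in> ell" "A = Affine x y" "Z = Affine z y'"
      "A \<notin> {Z, \<boxminus> Z}" for A Z x y z y'
      using that same_abscissa[of x y' y] by blast
    have "(V \<boxplus> T) \<boxplus> \<boxminus> V = T"
      using add_diff_cancel_ell[OF T(1) V] add_commute_ell[OF V T(1)] by simp
    then have VT: "V \<boxplus> T \<notin> {U, \<boxminus> U, V, \<boxminus> V}" using T by (auto simp: B_def)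
    have "w' \<noteq> u" by (rule x_ne[OF sums(2) U W' fin(1)]) (use VT in blast)
    moreover have "w' \<noteq> v" by (rule x_ne[OF sums(2) V W' fin(2)]) (use VT in blast)
    moreover have "t \<noteq> u" by (rule x_ne[OF T(1) U t fin(1)]) (use T in \<open>simp add: B_def N_def\<close>)
    moreover have "t \<noteq> v" by (rule x_ne[OF T(1) V t fin(2)]) (use T in \<open>simp add: B_def N_def\<close>)
    moreover have "t \<noteq> w" by (rule x_ne[OF T(1) sums(1) t W]) (use T in \<open>simp add: B_def N_def\<close>)
    ultimately have "(U \<boxplus> V) \<boxplus> T = (V \<boxplus> T) \<boxplus> U"
      using generic_assoc_ell[OF U V T(1) fin t W W'] by blast
    then show ?thesis using add_commute_ell[OF sums(2) U] by simp
  qed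
  moreover have "finite B" by (simp add: B_def N_def)
  ultimately show ?thesis by blast
qed

text \<open>An auxiliary \<open>T\<close> in general position is added on the right: four generic
  instances carry \<open>((P \<boxplus> Q) \<boxplus> R) \<boxplus> T\<close> to
  \<open>(P \<boxplus> (Q \<boxplus> R)) \<boxplus> T\<close>, and then \<open>T\<close> cancels.
  Cancellation was proved directly from the lines, so the argument is not circular.\<close>

lemma add_assoc_ell:
  assumes P: "P \<in> ell" and Q: "Q \<in> ell" and R: "R \<in> ell"
  shows "(P \<boxplus> Q) \<boxplus> R = P \<boxplus> (Q \<boxplus> R)"
proof -
  have PQ: "P \<boxplus> Q \<in> ell" and QR: "Q \<boxplus> R \<in> ell" using assms by auto
  obtain B1 where B1: "finite B1" "\<And>T. T \<in> ell \<Longrightarrow> T \<notin> B1 \<Longrightarrow>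
      ((P \<boxplus> Q) \<boxplus> R) \<boxplus> T = (P \<boxplus> Q) \<boxplus> (R \<boxplus> T)"
    using assoc_ell_cofinite[OF PQ R] by blast
  obtain B2 where B2: "finite B2" "\<And>T. T \<in> ell \<Longrightarrow> T \<notin> B2 \<Longrightarrow> (P \<boxplus> Q) \<boxplus> T = P \<boxplus> (Q \<boxplus> T)"
    using assoc_ell_cofinite[OF P Q] by blast
  obtain B3 where B3: "finite B3" "\<And>T. T \<in> ell \<Longrightarrow> T \<notin> B3 \<Longrightarrow> (Q \<boxplus> R) \<boxplus> T = Q \<boxplus> (R \<boxplus> T)"
    using assoc_ell_cofinite[OF Q R] by blast
  obtain B4 where B4: "finite B4" "\<And>T. T \<in> ell \<Longrightarrow> T \<notin> B4 \<Longrightarrow>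
      (P \<boxplus> (Q \<boxplus> R)) \<boxplus> T = P \<boxplus> ((Q \<boxplus> R) \<boxplus> T)"
    using assoc_ell_cofinite[OF P QR] by blast
  have "finite (B1 \<union> (\<lambda>S. S \<boxplus> \<boxminus> R) ` B2 \<union> B3 \<union> B4)" using B1 B2 B3 B4 by auto
  then obtain T where T: "T \<in> ell" "T \<notin> B1" "T \<notin> (\<lambda>S. S \<boxplus> \<boxminus> R) ` B2" "T \<notin> B3" "T \<notin> B4"
    by (rule ell_avoid_finite) blast
  have RT: "R \<boxplus> T \<in> ell" using R T by simp
  have "(R \<boxplus> T) \<boxplus> \<boxminus> R = T"
    using add_diff_cancel_ell[OF T(1) R] add_commute_ell[OF T(1) R] by simp
  then have RT_B2: "R \<boxplus> T \<notin> B2" using T(3) by force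
  have "((P \<boxplus> Q) \<boxplus> R) \<boxplus> T = P \<boxplus> (Q \<boxplus> (R \<boxplus> T))"
    using B1(2)[OF T(1,2)] B2(2)[OF RT RT_B2] by (simp only:)
  also have "\<dots> = (P \<boxplus> (Q \<boxplus> R)) \<boxplus> T"
    using B3(2)[OF T(1,4)] B4(2)[OF T(1,5)] by (simp only:)
  finally show ?thesis
    using add_right_cancel_ell[OF add_in_ell[OF PQ R] add_in_ell[OF P QR] T(1)] by blast
qed

abbreviation EC :: "complex curve_point monoid" where
  "EC \<equiv> point_group cremona_32a2 UNIV"

lemma coords_in_UNIV [simp]: "coords_in UNIV P"
  by (cases P) auto

lemma EC_simps [simp]: "carrier EC = ell" "monoid.mult EC = (\<boxplus>)" "one EC = Infinity"
  by (auto simp: point_group_def ell_def)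

interpretation EC: comm_group EC
proof (rule comm_groupI)
  show "\<exists>y\<in>carrier EC. y \<otimes>\<^bsub>EC\<^esub> x = \<one>\<^bsub>EC\<^esub>" if "x \<in> carrier EC" for x
    using that by (intro bexI[of _ "\<boxminus> x"]) (auto simp: add_eq_Infinity_iff)
  show "x \<otimes>\<^bsub>EC\<^esub> y = y \<otimes>\<^bsub>EC\<^esub> x" if "x \<in> carrier EC" "y \<in> carrier EC" for x y
    using that add_commute_ell by simp
  show "(x \<otimes>\<^bsub>EC\<^esub> y) \<otimes>\<^bsub>EC\<^esub> z = x \<otimes>\<^bsub>EC\<^esub> (y \<otimes>\<^bsub>EC\<^esub> z)"
    if "x \<in> carrier EC" "y \<in> carrier EC" "z \<in> carrier EC" for x y z
    using that add_assoc_ell by simp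
qed auto

lemma inv_EC [simp]: "P \<in> ell \<Longrightarrow> inv\<^bsub>EC\<^esub> P = \<boxminus> P"
  using EC.inv_equality[of "\<boxminus> P" P] by (auto simp: add_eq_Infinity_iff)

section \<open>Infinite descent\<close>

lemma square_factor_nat:
  fixes a b k :: nat
  assumes "coprime a b" "a * b = k\<^sup>2" "b > 0"
  obtains r where "a = r\<^sup>2"
proof -
  have "is_nth_power 2 (a * b)" using assms(2) by (auto simp: is_nth_power_def)
  then have "is_nth_power 2 a"
    using assms is_nth_power_mult_coprime_natD(1)[of a b 2]
    by (cases "a = 0") (auto simp: is_nth_power_def intro: exI[of _ 0])
  then show ?thesis using that by (auto simp: is_nth_power_def)
qed

text \<open>For \<open>c = 2\<close> the prime 2 must divide \<open>b\<close>, as \<open>a\<close>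
  is odd; removing it leaves coprime factors whose product is a square.\<close>

lemma odd_square_factor_nat:
  fixes a b c k :: nat
  assumes "coprime a b" "a * b = c * k\<^sup>2" "b > 0" "odd a" "c \<in> {1, 2}"
  obtains r where "a = r\<^sup>2"
proof (cases "c = 1")
  case True
  then show ?thesis using square_factor_nat[of a b k] assms that by auto
next
  case False
  then have c: "c = 2" using assms by auto
  then have "even b" using assms(2,4) by (metis even_mult_iff even_numeral)
  then obtain b' where b: "b = 2 * b'" by (elim evenE)
  then have "a * b' = k\<^sup>2" "b' > 0" "coprime a b'" using assms c by auto
  then show ?thesis using square_factor_nat[of a b' k] that by auto
qed

lemma pythagorean_triple_nat:
  fixes u v r :: nat
  assumes "coprime u v" "even u" "odd v" "u > 0" "u\<^sup>2 + v\<^sup>2 = r\<^sup>2"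
  obtains m n where "u = 2 * m * n" "m\<^sup>2 = v + n\<^sup>2" "coprime m n" "r = m\<^sup>2 + n\<^sup>2"
    "n > 0" "n < m" "odd (m + n)"
proof -
  have "odd r" using assms(2,3,5) by (metis even_add even_power pos2)
  have "v < r" 
    using assms(4,5) by (metis less_add_same_cancel2 power_less_imp_less_base zero_le zero_less_power)
  obtain d where d: "r = v + 2 * d"
    using \<open>odd r\<close> assms(3) \<open>v < r\<close> 
    by (metis add_diff_inverse_nat evenE even_diff_nat not_less_iff_gr_or_eq odd_add)
  obtain w where w: "u = 2 * w" using assms(2) by (elim evenE)
  have "d > 0" using d \<open>v < r\<close> by simp
  \<comment> \<open>These factors are \<open>(r + v) / 2\<close> and \<open>(r - v) / 2\<close>,
    with product \<open>(u / 2)^2\<close>.\<close>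
  have prod: "(v + d) * d = w\<^sup>2"
    using assms(5) unfolding d w by (simp add: power2_eq_square algebra_simps)
  have cop: "coprime (v + d) d"
  proof (rule coprimeI)
    fix e assume e: "e dvd v + d" "e dvd d"
    then have "e dvd v" by (metis dvd_add_left_iff)
    have "e * e dvd (v + d) * d" using e by (intro mult_dvd_mono)
    then have "e\<^sup>2 dvd w\<^sup>2" unfolding prod by (simp only: power2_eq_square)
    then have "e dvd w" by (simp only: pow_divides_pow_iff pos2)
    then have "e dvd u" unfolding w by simp
    then show "is_unit e" using \<open>e dvd v\<close> assms(1) by (meson coprime_common_divisor)
  qed
  obtain m where m: "v + d = m\<^sup>2" using square_factor_nat[OF cop prod \<open>d > 0\<close>] by blast
  have "coprime d (v + d)" "d * (v + d) = w\<^sup>2" "v + d > 0"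
    using cop prod \<open>d > 0\<close> by (simp_all add: coprime_commute mult.commute)
  then obtain n where n: "d = n\<^sup>2" using square_factor_nat[of d "v + d" w] by blast
  have "(m * n)\<^sup>2 = w\<^sup>2" using prod m n by (simp add: power_mult_distrib)
  then have "u = 2 * m * n" using w by (simp add: power2_eq_iff_nonneg)
  moreover have mv: "m\<^sup>2 = v + n\<^sup>2" using m n by simp
  moreover have "coprime (m\<^sup>2) (n\<^sup>2)" using cop m n by metis
  then have "coprime m n" by simp
  moreover have "r = m\<^sup>2 + n\<^sup>2" using d m n by simp
  moreover have "n > 0" using \<open>d > 0\<close> n by simp
  moreover have "n < m"
    using mv assms(3) by (metis less_add_same_cancel2 odd_pos power_less_imp_less_base zero_le)
  moreover have "odd (m + n)"
    using mv assms(3) by (metis even_add even_power pos2)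
  ultimately show ?thesis using that by blast
qed

lemma square_multiple_nat:
  fixes b c s k :: nat
  assumes "b * s\<^sup>2 = c * k\<^sup>2" "c \<in> {1, 2}" "even b" "s > 0"
  obtains j where "b = c * j\<^sup>2"
proof -
  obtain b' where b': "b = c * b'" using assms(2,3) by (auto elim: evenE)
  then have eq: "b' * s\<^sup>2 = k\<^sup>2" using assms(1,2) by auto
  then have "s\<^sup>2 dvd k\<^sup>2" by (metis dvd_triv_right)
  then have "s dvd k" by (simp only: pow_divides_pow_iff pos2)
  then obtain j where "k = s * j" by (elim dvdE)
  then have "b' = j\<^sup>2" using eq assms(4) by (simp add: power_mult_distrib)
  then show ?thesis using that b' by blast
qed

lemma quarter_square_nat:
  fixes c j k :: nat
  assumes "4 * k = c * j\<^sup>2" "c \<in> {1, 2}"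
  obtains i where "k = c * i\<^sup>2"
proof -
  have "even (j\<^sup>2)"
  proof (cases "c = 1")
    case True
    then have "j\<^sup>2 = 2 * (2 * k)" using assms(1) by simp
    then show ?thesis by (metis dvd_triv_left)
  next
    case False
    then have "j\<^sup>2 = 2 * k" using assms by simp
    then show ?thesis by (metis dvd_triv_left)
  qed
  then obtain i where "j = 2 * i" by (auto elim: evenE)
  then have "k = c * i\<^sup>2" using assms(1) by (simp add: power_mult_distrib)
  then show ?thesis using that by blast
qed

text \<open>\<open>m n (m + n) (m - n)\<close> is the area of the Pythagorean triangle with legs \<open>2 m n\<close> and
  \<open>m\<^sup>2 - n\<^sup>2\<close>, so the descent step rebuilds a triangle whose area is again \<open>c\<close>
  times a square from the factorisation of \<open>a b (a + b) (a - b)\<close>.\<close>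

lemma no_area_square:
  fixes a b c d k :: nat
  assumes "c \<in> {1, 2}" "coprime a b" "odd (a + b)" "0 < b" "0 < d" "a = b + d"
    "a * b * (a + b) * d = c * k\<^sup>2"
  shows False
  using assms(2-)
proof (induction a arbitrary: b d k rule: less_induct)
  case (less a)
  have "odd d" using less.prems by auto
  have bd: "coprime b d" using less.prems(1,5) 
    by (metis coprime_commute coprime_iff_gcd_eq_1 gcd_add2)
  have ad: "coprime a d" using less.prems(5) bd
    by (metis coprime_iff_gcd_eq_1 gcd_add1 )
  have aab: "coprime (a + b) a" "coprime (a + b) b" using less.prems(1)
    by (metis coprime_iff_gcd_eq_1 gcd_add1 gcd.commute add.commute)+
  have "a + b = 2 * b + d" using less.prems(5) by simp
  moreover have "coprime (2 * b) d" using bd \<open>odd d\<close> by simp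
  ultimately have abd: "coprime (a + b) d"
    by (simp only: coprime_iff_gcd_eq_1 gcd_add1)
  \<comment> \<open>The four factors are pairwise coprime, and \<open>a + b\<close> and
    \<open>d\<close> are odd, so these two are perfect squares for either value of
    \<open>c\<close>.\<close>
  obtain p where p: "a + b = p\<^sup>2"
    using odd_square_factor_nat[of "a + b" "a * b * d" c k] less.prems assms(1) aab abd
    by (auto simp: mult_ac)
  obtain q where q: "d = q\<^sup>2"
    using odd_square_factor_nat[of d "a * b * (a + b)" c k] less.prems assms(1) ad bd abd \<open>odd d\<close>
    by (auto simp: mult_ac coprime_commute)
  have oddpq: "odd p" "odd q" using less.prems(2) \<open>odd d\<close> p q by auto
  have "q\<^sup>2 < p\<^sup>2" using p q less.prems(3,5) by simp
  then have "q < p" by (rule power_less_imp_less_base) simp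
  moreover from this have "even (p - q)" using oddpq by simp
  ultimately obtain v where v: "p = q + 2 * v" by (metis evenE le_add_diff_inverse less_imp_le)
  \<comment> \<open>Now \<open>u\<close> and \<open>v\<close> are \<open>(p + q) / 2\<close> and
    \<open>(p - q) / 2\<close>, so that \<open>a\<close>, half of \<open>p^2 + q^2\<close>, becomes
    a sum of two squares and \<open>b\<close>, half of \<open>p^2 - q^2\<close>, a product.\<close>
  define u where "u = q + v"
  have "v > 0" "u > 0" using v \<open>q < p\<close> oddpq by (auto simp: u_def odd_pos)
  have "2 * a = p\<^sup>2 + q\<^sup>2" "2 * b + q\<^sup>2 = p\<^sup>2" using p q less.prems(5) by auto
  then have a: "a = u\<^sup>2 + v\<^sup>2" and b: "b = 2 * u * v"
    unfolding v u_def by (auto simp: power2_eq_square algebra_simps)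
  have "odd a" using less.prems(2) b by simp
  then obtain r where r: "a = r\<^sup>2"
    using odd_square_factor_nat[of a "b * (a + b) * d" c k] less.prems assms(1) ad aab
    by (auto simp: mult_ac coprime_commute)
  have "b * (r * p * q)\<^sup>2 = b * (a * (a + b) * d)" using r p q by (simp add: power_mult_distrib)
  also have "\<dots> = c * k\<^sup>2" using less.prems(6) by (simp only: mult_ac)
  finally have "b * (r * p * q)\<^sup>2 = c * k\<^sup>2" .
  moreover have "even b" using b by simp
  moreover have "r * p * q > 0" using oddpq \<open>odd a\<close> r by (auto intro: Nat.gr0I)
  ultimately obtain j where j: "b = c * j\<^sup>2" using square_multiple_nat assms(1) by metis
  have uv: "coprime u v"
  proof (rule coprimeI)
    fix e assume "e dvd u" "e dvd v"
    then have "e dvd a" "e dvd b" unfolding a b by (simp_all add: power2_eq_square)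
    then show "is_unit e" using less.prems(1) coprime_common_divisor by blast
  qed
  \<comment> \<open>The legs \<open>u\<close>, \<open>v\<close> with hypotenuse \<open>r\<close>
    form the smaller triangle. Which leg is even is not known, so the step is stated for an even leg
    \<open>x\<close> and an odd leg \<open>y\<close>.\<close>
  have step: False
    if x: "coprime x y" "even x" "odd y" "x > 0" "x\<^sup>2 + y\<^sup>2 = r\<^sup>2" "2 * x * y = c * j\<^sup>2" for x y
  proof -
    obtain m n where mn: "x = 2 * m * n" "m\<^sup>2 = y + n\<^sup>2" "coprime m n" "r = m\<^sup>2 + n\<^sup>2"
      "n > 0" "n < m" "odd (m + n)"
      using pythagorean_triple_nat[OF x(1-5)] by blast
    define e where "e = m - n"
    have e: "m = n + e" "e > 0" using mn by (auto simp: e_def)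
    have "y = (m + n) * e" using mn(2) unfolding e(1) by (simp add: power2_eq_square algebra_simps)
    then have eq: "4 * (m * n * (m + n) * e) = c * j\<^sup>2" using x(6) mn(1) by simp
    then obtain i where "m * n * (m + n) * e = c * i\<^sup>2"
      using quarter_square_nat assms(1) by metis
    moreover have "m < a"
    proof -
      have "m \<le> m\<^sup>2" by (simp add: power2_eq_square)
      also have "\<dots> < r" using mn by simp
      also have "r \<le> r\<^sup>2" by (simp add: power2_eq_square)
      finally show ?thesis using r by simp
    qed
    ultimately show False using less.IH[of m n e i] mn e by blast
  qed
  have "odd (u + v)" using oddpq by (simp add: u_def)
  then consider "even u" "odd v" | "even v" "odd u" by auto
  then show False
  proof cases
    case 1
    then show False using step[of u v] uv \<open>u > 0\<close> a r b j by simp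
  next
    case 2
    then show False using step[of v u] uv \<open>v > 0\<close> a r b j by (simp add: coprime_commute mult_ac add.commute)
  qed
qed

text \<open>If \<open>a\<close> and \<open>b\<close> are both odd, their half sum \<open>u\<close>
  and half difference \<open>v\<close> have opposite parity and
  \<open>a b (a + b) (a - b) = 4 u v (u + v) (u - v)\<close>, which returns to the case already
  excluded.\<close>

lemma no_area_square_coprime:
  fixes a b c d k :: nat
  assumes "c \<in> {1, 2}" "coprime a b" "0 < b" "0 < d" "a = b + d"
  shows "a * b * (a + b) * d \<noteq> c * k\<^sup>2"
proof
  assume eq: "a * b * (a + b) * d = c * k\<^sup>2"
  show False
  proof (cases "odd (a + b)")
    case True
    then show False using no_area_square[OF assms(1,2) _ assms(3-5) eq] by simp
  next
    case False
    have "\<not> (even a \<and> even b)" using assms(2) by (metis coprime_common_divisor odd_one)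
    then have "odd a" "odd b" using False by auto
    then have "even d" using assms(5) by simp
    then obtain v where v: "d = 2 * v" by (elim evenE)
    define u where "u = v + b"
    have uv: "a = u + v" "u = v + b" using assms(5) v by (auto simp: u_def)
    have "4 * (u * v * (u + v) * b) = c * k\<^sup>2"
      using eq unfolding uv v by (simp add: algebra_simps)
    then obtain i where i: "u * v * (u + v) * b = c * i\<^sup>2"
      using quarter_square_nat assms(1) by metis
    have "coprime u v"
    proof (rule coprimeI)
      fix e assume e: "e dvd u" "e dvd v"
      then have "e dvd b" using uv(2) by (metis dvd_add_right_iff)
      moreover have "e dvd a" using e uv(1) by simp
      ultimately show "is_unit e" using assms(2) coprime_common_divisor by blast
    qed
    then show False
      using no_area_square[OF assms(1) _ _ _ _ uv(2) i] assms v uv(1) \<open>odd a\<close> by simp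
  qed
qed

section \<open>Rational points on the twists by 1, -1, 2, -2\<close>

lemma no_twisted_point_nat:
  fixes a b c n m :: nat
  assumes c: "c \<in> {1, 2}" and cop: "coprime a b" and "a > 0" "b > 0" "a \<noteq> b" "n > 0"
  shows "a * b * (a + b) * (max a b - min a b) * n\<^sup>2 \<noteq> c * m\<^sup>2"
proof
  assume eq: "a * b * (a + b) * (max a b - min a b) * n\<^sup>2 = c * m\<^sup>2"
  have "even (a * b * (a + b) * (max a b - min a b))" by auto
  then obtain k where k: "a * b * (a + b) * (max a b - min a b) = c * k\<^sup>2"
    using square_multiple_nat[OF eq c _ \<open>n > 0\<close>] by blast
  show False
  proof (cases "b < a")
    case True
    then show False
      using no_area_square_coprime[OF c cop \<open>b > 0\<close>, of "a - b" k] k by simp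
  next
    case False
    then show False
      using no_area_square_coprime[of c b a "b - a" k] k assms by (simp add: coprime_commute mult_ac add.commute)
  qed
qed

text \<open>Clearing denominators in \<open>x = A / B\<close> equates \<open>A B (A^2 - B^2)\<close>
  times a square with \<open>e\<close> times a square. Absolute values remove all signs, including
  that of \<open>e\<close>, so only \<open>c = 1\<close> and \<open>c = 2\<close> remain.\<close>

theorem twisted_rational_points:
  fixes x q e :: rat
  assumes e: "e \<in> {1, -1, 2, -2}" and eq: "x ^ 3 - x = e * q\<^sup>2"
  shows "q = 0"
proof (rule ccontr)
  assume "q \<noteq> 0"
  obtain A B :: int where x: "x = of_int A / of_int B" "B > 0" "coprime A B"
    by (metis quotient_of_div quotient_of_denom_pos quotient_of_coprime prod.exhaust)
  obtain m n :: int where q: "q = of_int m / of_int n" "n > 0"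
    by (metis quotient_of_div quotient_of_denom_pos prod.exhaust)
  have "x ^ 3 - x \<noteq> 0" using eq e \<open>q \<noteq> 0\<close> by auto
  then have "x * (x - 1) * (x + 1) \<noteq> 0" by (simp add: power3_eq_cube algebra_simps)
  then have "A \<noteq> 0" "\<bar>A\<bar> \<noteq> B" using x by (auto simp: field_simps abs_if split: if_splits)
  obtain e' where e': "e = of_int e'" "nat \<bar>e'\<bar> \<in> {1, 2}"
  proof -
    have "\<exists>e'. e = of_int e' \<and> nat \<bar>e'\<bar> \<in> {1, 2}"
      using e by (elim insertE) (force intro: exI[of _ 1] exI[of _ "-1"] exI[of _ 2] exI[of _ "-2"])+
    then show ?thesis using that by blast
  qed
  have AM: "of_int A = x * of_int B" "of_int m = q * of_int n"
    using x(2) q(2) unfolding x(1) q(1) by simp_all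
  have "of_int (A * (A\<^sup>2 - B\<^sup>2) * B * n\<^sup>2) = (x ^ 3 - x) * of_int (B ^ 4 * n\<^sup>2)"
    by (simp add: AM algebra_simps power2_eq_square power3_eq_cube power4_eq_xxxx)
  also have "\<dots> = (of_int (e' * (m * B\<^sup>2)\<^sup>2) :: rat)"
    unfolding eq by (simp add: AM e'(1) algebra_simps power2_eq_square power4_eq_xxxx)
  finally have "(of_int (A * (A\<^sup>2 - B\<^sup>2) * B * n\<^sup>2) :: rat) = of_int (e' * (m * B\<^sup>2)\<^sup>2)" .
  then have "A * (A\<^sup>2 - B\<^sup>2) * B * n\<^sup>2 = e' * (m * B\<^sup>2)\<^sup>2" by (simp only: of_int_eq_iff)
  then have "\<bar>A\<bar> * \<bar>A\<^sup>2 - B\<^sup>2\<bar> * \<bar>B\<bar> * \<bar>n\<bar>\<^sup>2 = \<bar>e'\<bar> * (\<bar>m\<bar> * \<bar>B\<bar>\<^sup>2)\<^sup>2"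
    by (metis abs_mult power_abs)
  moreover have "\<bar>A\<^sup>2 - B\<^sup>2\<bar> = (\<bar>A\<bar> + \<bar>B\<bar>) * (max (\<bar>A\<bar>) (\<bar>B\<bar>) - min (\<bar>A\<bar>) (\<bar>B\<bar>))"
  proof -
    have "A\<^sup>2 - B\<^sup>2 = (\<bar>A\<bar> + \<bar>B\<bar>) * (\<bar>A\<bar> - \<bar>B\<bar>)" by (simp add: algebra_simps power2_eq_square)
    then show ?thesis by (simp add: abs_mult max_def min_def)
  qed
  ultimately have "\<bar>A\<bar> * \<bar>B\<bar> * (\<bar>A\<bar> + \<bar>B\<bar>) * (max (\<bar>A\<bar>) (\<bar>B\<bar>) - min (\<bar>A\<bar>) (\<bar>B\<bar>)) * \<bar>n\<bar>\<^sup>2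
      = \<bar>e'\<bar> * (\<bar>m\<bar> * \<bar>B\<bar>\<^sup>2)\<^sup>2" by (simp add: mult_ac)
  moreover obtain a b N M c :: nat where nat: "\<bar>A\<bar> = int a" "\<bar>B\<bar> = int b" "\<bar>n\<bar> = int N" "\<bar>m\<bar> * \<bar>B\<bar>\<^sup>2 = int M"
      "\<bar>e'\<bar> = int c"
    by (metis abs_ge_zero nonneg_int_cases zero_le_mult_iff zero_le_power)
  moreover have "max (int a) (int b) - min (int a) (int b) = int (max a b - min a b)" by auto
  ultimately have "int (a * b * (a + b) * (max a b - min a b) * N\<^sup>2) = int (c * M\<^sup>2)"
    by (simp only: of_nat_mult of_nat_add of_nat_power)
  then have "a * b * (a + b) * (max a b - min a b) * N\<^sup>2 = c * M\<^sup>2" by (simp only: of_nat_eq_iff)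
  moreover have "coprime a b" using x(3) nat by (metis coprime_abs_left_iff coprime_abs_right_iff coprime_int_iff)
  moreover have "a > 0" "b > 0" "a \<noteq> b" "N > 0" "c \<in> {1, 2}"
    using nat x q \<open>A \<noteq> 0\<close> \<open>\<bar>A\<bar> \<noteq> B\<close> e' by auto
  ultimately show False using no_twisted_point_nat by blast
qed

section \<open>Torsion points with rational abscissa\<close>

lemma double_Affine:
  assumes "Affine x y \<in> ell" "y \<noteq> 0"
  obtains y' where "Affine x y \<boxplus> Affine x y = Affine (((x\<^sup>2 + 1) / (2 * y))\<^sup>2) y'"
proof -
  have y: "y\<^sup>2 = x ^ 3 - x" using assms(1) by (simp add: Affine_in_ell)
  have eq: "(3 * x\<^sup>2 - 1)\<^sup>2 - 2 * x * (4 * y\<^sup>2) = (x\<^sup>2 + 1)\<^sup>2"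
    unfolding y by (simp add: power2_eq_square power3_eq_cube algebra_simps)
  have frac: "n / d - x - x = (n - 2 * x * d) / d" if "d \<noteq> 0" for n d :: complex
    using that by (simp add: field_simps)
  have "((3 * x\<^sup>2 - 1) / (2 * y))\<^sup>2 - x - x = (3 * x\<^sup>2 - 1)\<^sup>2 / (4 * y\<^sup>2) - x - x"
    by (simp only: power_divide power_mult_distrib) simp
  also have "\<dots> = ((3 * x\<^sup>2 - 1)\<^sup>2 - 2 * x * (4 * y\<^sup>2)) / (4 * y\<^sup>2)"
    using assms(2) by (intro frac) simp
  also have "\<dots> = ((x\<^sup>2 + 1) / (2 * y))\<^sup>2" by (simp only: eq power_divide power_mult_distrib) simp
  finally show ?thesis
    using assms(2) that by (simp add: add_Affine Let_def)
qed

text \<open>With \<open>double_Affine\<close> this is the easy direction of complete 2-descent: the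
  abscissa of a double differs from each of 0, 1, -1 by a square of the field over which the half is
  defined.\<close>

lemma double_abscissa_shift:
  assumes "Affine x y \<in> ell" "y \<noteq> 0"
  shows "((x\<^sup>2 + 1) / (2 * y))\<^sup>2 - 1 = ((x\<^sup>2 - 2 * x - 1) / (2 * y))\<^sup>2"
    "((x\<^sup>2 + 1) / (2 * y))\<^sup>2 + 1 = ((x\<^sup>2 + 2 * x - 1) / (2 * y))\<^sup>2"
proof -
  have y: "(2 * y)\<^sup>2 = 4 * (x ^ 3 - x)" using assms(1) by (simp add: Affine_in_ell power_mult_distrib)
  have nz: "(2 * y)\<^sup>2 \<noteq> 0" using assms(2) by simp
  have "(x\<^sup>2 + 1)\<^sup>2 - (2 * y)\<^sup>2 = (x\<^sup>2 - 2 * x - 1)\<^sup>2"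
    unfolding y by (simp add: power2_eq_square power3_eq_cube algebra_simps)
  then show "((x\<^sup>2 + 1) / (2 * y))\<^sup>2 - 1 = ((x\<^sup>2 - 2 * x - 1) / (2 * y))\<^sup>2"
    unfolding power_divide by (metis diff_divide_distrib divide_self[OF nz])
  have "(x\<^sup>2 + 1)\<^sup>2 + (2 * y)\<^sup>2 = (x\<^sup>2 + 2 * x - 1)\<^sup>2"
    unfolding y by (simp add: power2_eq_square power3_eq_cube algebra_simps)
  then show "((x\<^sup>2 + 1) / (2 * y))\<^sup>2 + 1 = ((x\<^sup>2 + 2 * x - 1) / (2 * y))\<^sup>2"
    unfolding power_divide by (metis add_divide_distrib divide_self[OF nz])
qed

text \<open>For coprime \<open>a\<close>, \<open>b\<close> of opposite parity the doubling formula
  \<open>(a\<^sup>2 + b\<^sup>2)\<^sup>2 / (4 a b (a\<^sup>2 - b\<^sup>2))\<close> is in lowest terms, again of opposite parity, so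
  the numerators along a doubling orbit grow without bound.\<close>

definition mixed_parity_abscissa :: "complex curve_point \<Rightarrow> nat \<Rightarrow> bool" where
  "mixed_parity_abscissa P N \<longleftrightarrow> (\<exists>a b y. P = Affine (of_int a / of_int b) y \<and>
     coprime a b \<and> odd (a + b) \<and> a \<noteq> 0 \<and> b \<noteq> 0 \<and> int N \<le> \<bar>a\<bar>)"

lemma mixed_parity_abscissaI:
  assumes "coprime a b" "odd (a + b)" "a \<noteq> 0" "b \<noteq> 0" "int N \<le> \<bar>a\<bar>"
  shows "mixed_parity_abscissa (Affine (of_int a / of_int b) y) N"
  unfolding mixed_parity_abscissa_def using assms by blast

lemma double_int_abscissa:
  fixes a b :: int
  assumes "Affine (of_int a / of_int b) y \<in> ell" "y \<noteq> 0" "b \<noteq> 0"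
  obtains y' where "Affine (of_int a / of_int b) y \<boxplus> Affine (of_int a / of_int b) y =
    Affine (of_int ((a\<^sup>2 + b\<^sup>2)\<^sup>2) / of_int (4 * a * b * (a\<^sup>2 - b\<^sup>2))) y'"
    "a \<noteq> 0" "a\<^sup>2 - b\<^sup>2 \<noteq> 0"
proof -
  define x :: complex where "x = of_int a / of_int b"
  have ab: "of_int a = x * of_int b" using assms(3) by (simp add: x_def)
  have y: "(2 * y)\<^sup>2 = 4 * (x ^ 3 - x)"
    using assms(1) by (simp add: Affine_in_ell x_def power_mult_distrib)
  have num: "of_int ((a\<^sup>2 + b\<^sup>2)\<^sup>2) = (x\<^sup>2 + 1)\<^sup>2 * of_int b ^ 4"
    by (simp add: ab algebra_simps power2_eq_square power4_eq_xxxx)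
  have den: "of_int (4 * a * b * (a\<^sup>2 - b\<^sup>2)) = (2 * y)\<^sup>2 * of_int b ^ 4"
    by (simp only: y) (simp add: ab algebra_simps power2_eq_square power3_eq_cube power4_eq_xxxx)
  have "((x\<^sup>2 + 1) / (2 * y))\<^sup>2 = of_int ((a\<^sup>2 + b\<^sup>2)\<^sup>2) / of_int (4 * a * b * (a\<^sup>2 - b\<^sup>2))"
    unfolding num den power_divide using assms(3) by simp
  moreover have "4 * a * b * (a\<^sup>2 - b\<^sup>2) \<noteq> 0"
    using den assms(2,3) by (metis mult_eq_0_iff of_int_0 of_int_eq_0_iff power_not_zero zero_neq_numeral)
  ultimately show ?thesis
    using double_Affine[OF assms(1,2)] that unfolding x_def by auto
qed

lemma coprime_sum_squares:
  fixes a b :: int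
  assumes "coprime a b"
  shows "coprime (a\<^sup>2 + b\<^sup>2) a" "coprime (a\<^sup>2 + b\<^sup>2) b"
proof -
  have "gcd a (a * a + b\<^sup>2) = gcd a (b\<^sup>2)" "gcd b (b * b + a\<^sup>2) = gcd b (a\<^sup>2)"
    by (rule gcd_add_mult)+
  moreover have "coprime a (b\<^sup>2)" "coprime b (a\<^sup>2)" using assms by (simp_all add: coprime_commute)
  ultimately show "coprime (a\<^sup>2 + b\<^sup>2) a" "coprime (a\<^sup>2 + b\<^sup>2) b"
    by (simp_all only: coprime_iff_gcd_eq_1 power2_eq_square gcd.commute[of "a * a + b * b"] add.commute)
qed

lemma mixed_parity_double:
  assumes "P \<in> ell" "mixed_parity_abscissa P N"
  shows "mixed_parity_abscissa (P \<boxplus> P) (Suc N)"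
proof -
  obtain a b y where P: "P = Affine (of_int a / of_int b) y" and cop: "coprime a b"
    and odd: "odd (a + b)" and nz: "a \<noteq> 0" "b \<noteq> 0" and N: "int N \<le> \<bar>a\<bar>"
    using assms(2) by (auto simp: mixed_parity_abscissa_def)
  define s where "s = a\<^sup>2 + b\<^sup>2"
  have "a\<^sup>2 \<noteq> b\<^sup>2" using odd by (metis even_add even_power pos2)
  have "y \<noteq> 0"
  proof
    define x :: complex where "x = of_int a / of_int b"
    assume "y = 0"
    then have "x ^ 3 - x = 0"
      using assms(1) unfolding P x_def[symmetric] by (simp add: Affine_in_ell)
    then have "x * (x\<^sup>2 - 1) = 0" by (simp add: power3_eq_cube power2_eq_square algebra_simps)
    then have "x\<^sup>2 = 1" using nz by (auto simp: x_def)
    then have "(of_int (a\<^sup>2) :: complex) = of_int (b\<^sup>2)" using nz by (simp add: x_def power_divide divide_eq_1_iff)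
    then show False using \<open>a\<^sup>2 \<noteq> b\<^sup>2\<close> by (simp only: of_int_eq_iff)
  qed
  obtain y' where D: "P \<boxplus> P = Affine (of_int (s\<^sup>2) / of_int (4 * a * b * (a\<^sup>2 - b\<^sup>2))) y'"
    using double_int_abscissa[of a b y] assms(1) \<open>y \<noteq> 0\<close> nz unfolding P s_def by metis
  have "odd s" using odd by (simp add: s_def)
  then have s2: "coprime s 2" by simp
  have sab: "coprime s a" "coprime s b" using coprime_sum_squares[OF cop] by (simp_all add: s_def)
  have "coprime s (2 * b\<^sup>2)" using s2 sab by simp
  then have "coprime s (s - 2 * b\<^sup>2)" by (metis coprime_iff_gcd_eq_1 gcd_diff2 gcd.commute)
  then have "coprime s (a\<^sup>2 - b\<^sup>2)" by (simp add: s_def)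
  moreover have "coprime s (2 * 2)" using s2 by (simp only: coprime_mult_right_iff)
  ultimately have "coprime (s\<^sup>2) (4 * a * b * (a\<^sup>2 - b\<^sup>2))" using sab by simp
  moreover have "odd (s\<^sup>2 + 4 * a * b * (a\<^sup>2 - b\<^sup>2))" using \<open>odd s\<close> by simp
  moreover have "s\<^sup>2 \<noteq> 0" "4 * a * b * (a\<^sup>2 - b\<^sup>2) \<noteq> 0" using \<open>odd s\<close> nz \<open>a\<^sup>2 \<noteq> b\<^sup>2\<close> by auto
  moreover have "int (Suc N) \<le> \<bar>s\<^sup>2\<bar>"
  proof -
    have sq: "\<bar>z\<bar> \<le> z\<^sup>2" for z :: int
    proof (cases "z = 0")
      case False
      then have "\<bar>z\<bar> * 1 \<le> \<bar>z\<bar> * \<bar>z\<bar>" by (intro mult_left_mono) auto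
      then show ?thesis by (simp add: power2_eq_square)
    qed simp
    have "b\<^sup>2 > 0" using nz by simp
    then have "int (Suc N) \<le> s" using N sq[of a] unfolding s_def by linarith
    also have "s \<le> s\<^sup>2" using sq[of s] by simp
    finally show ?thesis by simp
  qed
  ultimately show ?thesis unfolding D by (rule mixed_parity_abscissaI)
qed

text \<open>The case left over is \<open>a\<close> and \<open>b\<close> both odd. Then
  \<open>a^2 + b^2\<close> is twice an odd number, so the 4 in the doubling formula cancels, and the
  doubled abscissa has odd numerator and even denominator in lowest terms.\<close>

lemma mixed_parity_start:
  assumes "Affine x y \<in> ell" "y \<noteq> 0" "x \<in> \<rat>"
  shows "mixed_parity_abscissa (Affine x y) 0 \<or>
    mixed_parity_abscissa (Affine x y \<boxplus> Affine x y) 0"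
proof -
  obtain a b :: int where x: "x = of_int a / of_int b" "b > 0" "coprime a b"
    using assms(3) by (rule Rats_cases') 
  obtain y' where D: "Affine x y \<boxplus> Affine x y =
      Affine (of_int ((a\<^sup>2 + b\<^sup>2)\<^sup>2) / of_int (4 * a * b * (a\<^sup>2 - b\<^sup>2))) y'"
    and nz: "a \<noteq> 0" "a\<^sup>2 - b\<^sup>2 \<noteq> 0"
    using double_int_abscissa[of a b y] assms x by auto
  show ?thesis
  proof (cases "odd (a + b)")
    case True
    then show ?thesis using x nz by (auto simp: mixed_parity_abscissa_def)
  next
    case False
    moreover have "\<not> (even a \<and> even b)" using x(3) by (metis coprime_common_divisor odd_one)
    ultimately have odd: "odd a" "odd b" by auto
    then obtain i j where ij: "a = 2 * i + 1" "b = 2 * j + 1" by (metis oddE)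
    define s where "s = 2 * (i * i + i + j * j + j) + 1"
    have s: "a\<^sup>2 + b\<^sup>2 = 2 * s" unfolding ij s_def by (simp add: power2_eq_square algebra_simps)
    have "odd s" by (simp add: s_def)
    then have "coprime s 2" by simp
    have sab: "coprime s a" "coprime s b" using coprime_sum_squares[OF x(3)] unfolding s by simp_all
    then have "coprime s (s - b\<^sup>2)" by (metis coprime_iff_gcd_eq_1 coprime_power_right_iff gcd_diff2 gcd.commute)
    then have "coprime s (2 * (s - b\<^sup>2))" using \<open>coprime s 2\<close>
      by (simp only: coprime_mult_right_iff simp_thms)
    moreover have "2 * (s - b\<^sup>2) = a\<^sup>2 - b\<^sup>2" using s by simp
    ultimately have "coprime (s\<^sup>2) (a * b * (a\<^sup>2 - b\<^sup>2))" using sab by simp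
    moreover have "odd (s\<^sup>2 + a * b * (a\<^sup>2 - b\<^sup>2))" using \<open>odd s\<close> odd by simp
    moreover have "s\<^sup>2 \<noteq> 0" "a * b * (a\<^sup>2 - b\<^sup>2) \<noteq> 0" using \<open>odd s\<close> nz x(2) by auto
    moreover have "int 0 \<le> \<bar>s\<^sup>2\<bar>" by simp
    ultimately have "mixed_parity_abscissa
        (Affine (of_int (s\<^sup>2) / of_int (a * b * (a\<^sup>2 - b\<^sup>2))) y') 0"
      by (rule mixed_parity_abscissaI)
    moreover have "(of_int ((a\<^sup>2 + b\<^sup>2)\<^sup>2) / of_int (4 * a * b * (a\<^sup>2 - b\<^sup>2)) :: complex) =
        of_int (s\<^sup>2) / of_int (a * b * (a\<^sup>2 - b\<^sup>2))"
      unfolding s by (simp add: power_mult_distrib)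
    ultimately show ?thesis unfolding D by (simp only: simp_thms)
  qed
qed

lemma mixed_parity_mono:
  assumes "mixed_parity_abscissa P N" "M \<le> N"
  shows "mixed_parity_abscissa P M"
proof -
  have "int N \<le> \<bar>a\<bar> \<Longrightarrow> int M \<le> \<bar>a\<bar>" for a using assms(2) by linarith
  then show ?thesis using assms(1) unfolding mixed_parity_abscissa_def by blast
qed

lemma mixed_parity_bounded: "\<exists>N. \<not> mixed_parity_abscissa P N"
proof (cases "mixed_parity_abscissa P 0")
  case True
  then obtain a b y where P: "P = Affine (of_int a / of_int b) y" "coprime a b" "b \<noteq> 0"
    by (auto simp: mixed_parity_abscissa_def)
  have same: "\<bar>c\<bar> = \<bar>a\<bar>"
    if c: "P = Affine (of_int c / of_int d) z" "coprime c d" "d \<noteq> 0" for c d z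
  proof -
    have "(of_int (a * d) :: complex) = of_int (c * b)"
      using c P by (simp add: frac_eq_eq)
    then have "a * d = c * b" by (simp only: of_int_eq_iff)
    then have "a dvd c * b" "c dvd a * d" by (intro dvdI[of _ _ d] dvdI[of _ _ b], simp)+
    then have "a dvd c" "c dvd a"
      using P(2) c(2) by (simp_all add: coprime_dvd_mult_left_iff)
    then show ?thesis by (intro zdvd_antisym_abs)
  qed
  have "\<not> mixed_parity_abscissa P (nat \<bar>a\<bar> + 1)"
  proof (rule notI)
    assume "mixed_parity_abscissa P (nat \<bar>a\<bar> + 1)"
    then obtain c d z where "P = Affine (of_int c / of_int d) z" "coprime c d" "d \<noteq> 0"
      and "int (nat \<bar>a\<bar> + 1) \<le> \<bar>c\<bar>"
      unfolding mixed_parity_abscissa_def by blast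
    then show False using same by force
  qed
  then show ?thesis by blast
qed blast

text \<open>Torsion would leave finitely many multiples of \<open>P\<close>, hence a common bound on
  their numerators, while the multiples by powers of 2 exceed every bound.\<close>

lemma mixed_parity_not_torsion:
  assumes "mixed_parity_abscissa P 0" "P \<in> ell"
  shows "P \<notin> torsion EC"
proof
  assume "P \<in> torsion EC"
  then obtain n :: nat where n: "n > 0" "P [^]\<^bsub>EC\<^esub> n = Infinity" by (auto simp: torsion_def)
  define S where "S = (\<lambda>m::nat. P [^]\<^bsub>EC\<^esub> m) ` {..<n}"
  have "P [^]\<^bsub>EC\<^esub> (m::nat) \<in> S" for m
  proof -
    have "P [^]\<^bsub>EC\<^esub> m = P [^]\<^bsub>EC\<^esub> (n * (m div n) + m mod n)" by simp
    also have "\<dots> = P [^]\<^bsub>EC\<^esub> (m mod n)"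
      using assms(2) n(2) EC.nat_pow_mult[of P "n * (m div n)" "m mod n"]
        EC.nat_pow_pow[of P n "m div n"] EC.nat_pow_one[of "m div n"] by simp
    finally show ?thesis using n(1) by (auto simp: S_def)
  qed
  moreover have "mixed_parity_abscissa (P [^]\<^bsub>EC\<^esub> ((2::nat) ^ j)) j" for j
  proof (induction j)
    case 0
    then show ?case using assms EC.nat_pow_eone[of P] by simp
  next
    case (Suc j)
    have "P [^]\<^bsub>EC\<^esub> ((2::nat) ^ Suc j) = P [^]\<^bsub>EC\<^esub> ((2::nat) ^ j) \<boxplus> P [^]\<^bsub>EC\<^esub> ((2::nat) ^ j)"
      using EC.nat_pow_mult[of P "2 ^ j" "2 ^ j"] assms(2) by (simp add: mult_2)
    then show ?case
      using mixed_parity_double[OF _ Suc] EC.nat_pow_closed[of P "2 ^ j"] assms(2) by simp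
  qed
  ultimately have large: "\<exists>Q\<in>S. mixed_parity_abscissa Q N" for N by metis
  obtain f where f: "\<not> mixed_parity_abscissa Q (f Q)" for Q using mixed_parity_bounded by metis
  obtain Q where Q: "Q \<in> S" "mixed_parity_abscissa Q (Max (f ` S))" using large by blast
  have "f Q \<le> Max (f ` S)" using Q(1) by (simp add: S_def)
  then show False using f mixed_parity_mono Q(2) by blast
qed

lemma torsion_add:
  assumes "P \<in> torsion EC" "Q \<in> torsion EC"
  shows "P \<boxplus> Q \<in> torsion EC"
proof -
  obtain m n :: nat where "m > 0" "P [^]\<^bsub>EC\<^esub> m = Infinity" "n > 0" "Q [^]\<^bsub>EC\<^esub> n = Infinity"
    and in_ell: "P \<in> ell" "Q \<in> ell" using assms by (auto simp: torsion_def)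
  then have "(P \<boxplus> Q) [^]\<^bsub>EC\<^esub> (m * n) = Infinity"
    using EC.nat_pow_distrib[of P Q "m * n"] EC.nat_pow_pow[of P m n] EC.nat_pow_pow[of Q n m]
      EC.nat_pow_one by (simp add: mult.commute)
  then show ?thesis using \<open>m > 0\<close> \<open>n > 0\<close> in_ell
    by (auto simp: torsion_def intro!: exI[of _ "m * n"])
qed

lemma torsion_neg:
  assumes "P \<in> torsion EC"
  shows "\<boxminus> P \<in> torsion EC"
  using assms EC.nat_pow_inv[of P] by (auto simp: torsion_def)

text \<open>The ordinate is an arbitrary complex number, so this treats the torsion on all rational
  twists of the curve at once.\<close>

theorem torsion_rational_abscissa:
  assumes "Affine x y \<in> torsion EC" "x \<in> \<rat>"
  shows "y = 0"
proof (rule ccontr)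
  assume "y \<noteq> 0"
  have P: "Affine x y \<in> ell" using assms by (simp add: torsion_def)
  from mixed_parity_start[OF P \<open>y \<noteq> 0\<close> assms(2)] show False
  proof
    assume "mixed_parity_abscissa (Affine x y) 0"
    then show False using mixed_parity_not_torsion P assms(1) by metis
  next
    assume "mixed_parity_abscissa (Affine x y \<boxplus> Affine x y) 0"
    then show False
      using mixed_parity_not_torsion add_in_ell[OF P P] torsion_add[OF assms(1) assms(1)] by metis
  qed
qed

section \<open>Towers of quadratic extensions\<close>

locale csubfield =
  fixes L :: "complex set"
  assumes one [simp]: "1 \<in> L"
    and diff [simp]: "\<And>a b. a \<in> L \<Longrightarrow> b \<in> L \<Longrightarrow> a - b \<in> L"
    and mult [simp]: "\<And>a b. a \<in> L \<Longrightarrow> b \<in> L \<Longrightarrow> a * b \<in> L"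
    and inverse [simp]: "\<And>a. a \<in> L \<Longrightarrow> inverse a \<in> L"
begin

lemma zero [simp]: "0 \<in> L"
  using diff[OF one one] by simp

lemma minus [simp]: "a \<in> L \<Longrightarrow> - a \<in> L"
  using diff[of 0 a] by simp

lemma add [simp]: "a \<in> L \<Longrightarrow> b \<in> L \<Longrightarrow> a + b \<in> L"
  using diff[of a "- b"] by simp

lemma divide [simp]: "a \<in> L \<Longrightarrow> b \<in> L \<Longrightarrow> a / b \<in> L"
  by (simp add: divide_inverse)

lemma power [simp]: "a \<in> L \<Longrightarrow> a ^ n \<in> L"
  by (induction n) auto

lemma of_nat [simp]: "of_nat n \<in> L"
  by (induction n) auto

lemma numeral [simp]: "numeral n \<in> L"
  using of_nat[of "numeral n"] by simp

lemma of_int [simp]: "of_int n \<in> L"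
  by (cases n rule: int_cases2) auto

lemma Rats_subset: "\<rat> \<subseteq> L"
proof
  fix z :: complex
  assume "z \<in> \<rat>"
  then obtain a b where "z = of_int a / of_int b" by (rule Rats_cases')
  then show "z \<in> L" by simp
qed

end

lemma csubfield_Rats: "csubfield \<rat>"
  by unfold_locales auto

section \<open>Adjoining a square root\<close>

definition adj :: "complex set \<Rightarrow> complex \<Rightarrow> complex set" where
  "adj L r = {a + b * r | a b. a \<in> L \<and> b \<in> L}"

lemma adjI: "a \<in> L \<Longrightarrow> b \<in> L \<Longrightarrow> a + b * r \<in> adj L r"
  by (auto simp: adj_def)

lemma adjE:
  assumes "z \<in> adj L r"
  obtains a b where "z = a + b * r" "a \<in> L" "b \<in> L"
  using assms by (auto simp: adj_def)

lemma adj_mono: "L \<subseteq> M \<Longrightarrow> adj L r \<subseteq> adj M r"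
  by (auto simp: adj_def)

context csubfield
begin

lemma subset_adj: "L \<subseteq> adj L r"
  using adjI[of _ L 0 r] by auto

lemma root_in_adj: "r \<in> adj L r"
  using adjI[of 0 L 1 r] by auto

lemma adj_trivial: "r \<in> L \<Longrightarrow> adj L r = L"
  using subset_adj by (auto simp: adj_def)

lemma adj_unique:
  assumes "a + b * r = c + d * r" "r \<notin> L" "a \<in> L" "b \<in> L" "c \<in> L" "d \<in> L"
  shows "a = c" "b = d"
proof -
  have "(b - d) * r = c - a" using assms(1) by (simp add: algebra_simps)
  moreover have "(c - a) / (b - d) \<in> L" using assms by simp
  ultimately have "b - d = 0"
    using assms(2) by (metis nonzero_mult_div_cancel_left)
  then show "b = d" by simp
  then show "a = c" using assms(1) by simp
qed

lemma csubfield_adj: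
  assumes "r\<^sup>2 \<in> L"
  shows "csubfield (adj L r)"
proof (cases "r \<in> L")
  case True
  then show ?thesis using adj_trivial csubfield_axioms by simp
next
  case False
  show ?thesis
  proof
    show "1 \<in> adj L r" using adjI[of 1 L 0] by simp
  next
    fix x y assume "x \<in> adj L r" "y \<in> adj L r"
    then obtain a b c d where xy: "x = a + b * r" "y = c + d * r"
      and L: "a \<in> L" "b \<in> L" "c \<in> L" "d \<in> L" by (meson adjE)
    have "x - y = (a - c) + (b - d) * r" "x * y = (a * c + b * d * r\<^sup>2) + (a * d + b * c) * r"
      by (simp_all add: xy algebra_simps power2_eq_square)
    then show "x - y \<in> adj L r" "x * y \<in> adj L r" using adjI L assms by simp_all
  next
    fix x assume "x \<in> adj L r"
    then obtain a b where x: "x = a + b * r" "a \<in> L" "b \<in> L" by (elim adjE)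
    show "inverse x \<in> adj L r"
    proof (cases "x = 0")
      case True
      then show ?thesis using adjI[of 0 L 0] by simp
    next
      case False
      define n where "n = a\<^sup>2 - b\<^sup>2 * r\<^sup>2"
      have n: "n = x * (a - b * r)" by (simp add: n_def x(1) algebra_simps power2_eq_square)
      have "a - b * r \<noteq> 0"
      proof
        assume "a - b * r = 0"
        then have "a + (- b) * r = 0 + 0 * r" by simp
        then have "a = 0" "- b = 0" using adj_unique[of a "- b" r 0 0] \<open>r \<notin> L\<close> x by simp_all
        then show False using False x by simp
      qed
      then have "inverse x = (a - b * r) / n" using n False by (simp add: inverse_eq_divide)
      also have "\<dots> = a / n + (- b / n) * r" by (simp add: diff_divide_distrib)
      finally have "inverse x = a / n + (- b / n) * r" .
      moreover have "n \<in> L" using x assms by (simp add: n_def)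
      ultimately show ?thesis using adjI[of "a / n" L "- b / n" r] x by simp
    qed
  qed
qed

lemma adj_conjugation:
  assumes "r\<^sup>2 \<in> L" "r \<notin> L"
  obtains \<sigma> where "\<And>a b. a \<in> L \<Longrightarrow> b \<in> L \<Longrightarrow> \<sigma> (a + b * r) = a - b * r"
proof -
  define \<sigma> where "\<sigma> z = (THE w. \<exists>a b. a \<in> L \<and> b \<in> L \<and> z = a + b * r \<and> w = a - b * r)" for z
  have "\<sigma> (a + b * r) = a - b * r" if "a \<in> L" "b \<in> L" for a b
    unfolding \<sigma>_def
  proof (rule the_equality)
    fix w assume "\<exists>c d. c \<in> L \<and> d \<in> L \<and> a + b * r = c + d * r \<and> w = c - d * r"
    then show "w = a - b * r" using adj_unique[OF _ assms(2)] that by metis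
  qed (use that in blast)
  then show ?thesis using that by blast
qed

end

text \<open>Points \<open>(x, s v)\<close> with \<open>x, v \<in> L\<close>: the \<open>L\<close>-points of the twist
  \<open>s\<^sup>2 v\<^sup>2 = x\<^sup>3 - x\<close>.\<close>

definition twist :: "complex set \<Rightarrow> complex \<Rightarrow> complex curve_point set" where
  "twist L s = {P \<in> ell. \<forall>x y. P = Affine x y \<longrightarrow> x \<in> L \<and> y / s \<in> L}"

lemma twist_in_ell: "P \<in> twist L s \<Longrightarrow> P \<in> ell"
  by (simp add: twist_def)

lemma Infinity_twist [simp]: "Infinity \<in> twist L s"
  by (simp add: twist_def)

lemma Affine_twist:
  "s \<noteq> 0 \<Longrightarrow> Affine x (s * v) \<in> twist L s \<longleftrightarrow> Affine x (s * v) \<in> ell \<and> x \<in> L \<and> v \<in> L"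
  by (auto simp: twist_def)

lemma twist_cases:
  assumes "P \<in> twist L s" "s \<noteq> 0"
  obtains "P = Infinity" | x v where "P = Affine x (s * v)" "x \<in> L" "v \<in> L"
proof (cases P)
  case (Affine x y)
  then have "P = Affine x (s * (y / s))" "x \<in> L" "y / s \<in> L" using assms by (auto simp: twist_def)
  then show ?thesis using that by blast
qed (use that in blast)

text \<open>The slope between such points is \<open>s\<close> times a quantity \<open>k\<close>
  rational in the coordinates \<open>x\<close>, \<open>v\<close> and in \<open>s^2\<close>. So
  \<open>s\<close> enters the new coordinates only through its square, and the twist is closed under
  addition over any field containing \<open>s^2\<close>.\<close>

lemma add_twist:
  assumes "s \<noteq> 0"
  shows "Affine x1 (s * v1) \<boxplus> Affine x2 (s * v2) =
     (if x1 = x2 \<and> v1 + v2 = 0 then Infinity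
      else let k = (if x1 = x2 then (3 * x1\<^sup>2 - 1) / (2 * s\<^sup>2 * v1) else (v2 - v1) / (x2 - x1));
               x3 = s\<^sup>2 * k\<^sup>2 - x1 - x2
           in Affine x3 (s * (k * (x1 - x3) - v1)))"
proof -
  have opp: "s * v1 + s * v2 = 0 \<longleftrightarrow> v1 + v2 = 0" using assms by (simp flip: distrib_left)
  have 1: "(3 * x1\<^sup>2 - 1) / (2 * (s * v1)) = s * ((3 * x1\<^sup>2 - 1) / (2 * s\<^sup>2 * v1))"
    using assms by (simp add: power2_eq_square)
  have 2: "(s * v2 - s * v1) / (x2 - x1) = s * ((v2 - v1) / (x2 - x1))"
    by (simp add: right_diff_distrib)
  have 3: "Affine ((s * k)\<^sup>2 - x1 - x2) (- (s * k * ((s * k)\<^sup>2 - x1 - x2) + (s * v1 - s * k * x1))) =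
      Affine (s\<^sup>2 * k\<^sup>2 - x1 - x2) (s * (k * (x1 - (s\<^sup>2 * k\<^sup>2 - x1 - x2)) - v1))" for k
    by (simp add: power_mult_distrib algebra_simps)
  show ?thesis
    unfolding add_Affine opp 1 2 Let_def if_distrib[of "(*) s", symmetric] 3 ..
qed

lemma (in csubfield) twist_add_closed:
  assumes "P \<in> twist L s" "Q \<in> twist L s" "s \<noteq> 0" "s\<^sup>2 \<in> L"
  shows "P \<boxplus> Q \<in> twist L s"
proof -
  have ell: "P \<boxplus> Q \<in> ell" using assms by (simp add: twist_in_ell)
  show ?thesis
    using assms(1,3)
  proof (cases rule: twist_cases)
    case P: (2 x1 v1)
    show ?thesis
      using assms(2,3)
    proof (cases rule: twist_cases)
      case Q: (2 x2 v2)
      show ?thesis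
        using ell P Q assms(4) unfolding P(1) Q(1)
        by (auto simp: add_twist[OF assms(3)] Affine_twist[OF assms(3)] Let_def split: if_splits)
    qed (use assms P in simp)
  qed (use assms in simp)
qed

lemma (in csubfield) twist_neg_closed:
  assumes "P \<in> twist L s"
  shows "\<boxminus> P \<in> twist L s"
  using assms by (cases P) (auto simp: twist_def Affine_in_ell)

lemma (in csubfield) twist_pow_closed:
  assumes "P \<in> twist L s" "s \<noteq> 0" "s\<^sup>2 \<in> L"
  shows "P [^]\<^bsub>EC\<^esub> (n::nat) \<in> twist L s"
  using assms by (induction n) (auto simp: twist_add_closed)

text \<open>Conjugation acts on the coordinate \<open>y / s\<close> and never on \<open>s\<close>:
  the number \<open>s\<close> may lie outside the field, and if it lies inside, conjugation may
  change its sign. Only \<open>s^2\<close> has to be fixed.\<close>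

fun twist_map :: "(complex \<Rightarrow> complex) \<Rightarrow> complex \<Rightarrow> complex curve_point \<Rightarrow> complex curve_point" where
  "twist_map \<sigma> s Infinity = Infinity"
| "twist_map \<sigma> s (Affine x y) = Affine (\<sigma> x) (s * \<sigma> (y / s))"

locale csubfield_involution = csubfield L for L +
  fixes \<sigma> :: "complex \<Rightarrow> complex"
  assumes \<sigma>_closed [simp]: "\<And>a. a \<in> L \<Longrightarrow> \<sigma> a \<in> L"
    and \<sigma>_diff [simp]: "\<And>a b. a \<in> L \<Longrightarrow> b \<in> L \<Longrightarrow> \<sigma> (a - b) = \<sigma> a - \<sigma> b"
    and \<sigma>_mult [simp]: "\<And>a b. a \<in> L \<Longrightarrow> b \<in> L \<Longrightarrow> \<sigma> (a * b) = \<sigma> a * \<sigma> b"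
    and \<sigma>_\<sigma> [simp]: "\<And>a. a \<in> L \<Longrightarrow> \<sigma> (\<sigma> a) = a"
begin

lemma \<sigma>_0 [simp]: "\<sigma> 0 = 0"
  using \<sigma>_diff[of 0 0] by simp

lemma \<sigma>_inj: "a \<in> L \<Longrightarrow> b \<in> L \<Longrightarrow> \<sigma> a = \<sigma> b \<longleftrightarrow> a = b"
  using \<sigma>_\<sigma> by metis

lemma \<sigma>_1 [simp]: "\<sigma> 1 = 1"
proof -
  have "\<sigma> 1 * \<sigma> 1 = \<sigma> 1 * 1" using \<sigma>_mult[of 1 1] by simp
  moreover have "\<sigma> 1 \<noteq> 0" using \<sigma>_inj[of 1 0] by simp
  ultimately show ?thesis by simp
qed

lemma \<sigma>_minus [simp]: "a \<in> L \<Longrightarrow> \<sigma> (- a) = - \<sigma> a"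
  using \<sigma>_diff[of 0 a] by simp

lemma \<sigma>_add [simp]: "a \<in> L \<Longrightarrow> b \<in> L \<Longrightarrow> \<sigma> (a + b) = \<sigma> a + \<sigma> b"
  using \<sigma>_diff[of a "- b"] by simp

lemma \<sigma>_divide [simp]:
  assumes "a \<in> L" "b \<in> L"
  shows "\<sigma> (a / b) = \<sigma> a / \<sigma> b"
proof (cases "b = 0")
  case False
  then have "\<sigma> b \<noteq> 0" using \<sigma>_inj[of b 0] assms by simp
  moreover have "\<sigma> (a / b) * \<sigma> b = \<sigma> a" using \<sigma>_mult[of "a / b" b] assms False by simp
  ultimately show ?thesis by (simp add: eq_divide_eq)
qed simp

lemma \<sigma>_power2 [simp]: "a \<in> L \<Longrightarrow> \<sigma> (a\<^sup>2) = (\<sigma> a)\<^sup>2"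
  by (simp add: power2_eq_square)

lemma \<sigma>_2 [simp]: "\<sigma> 2 = 2"
  using \<sigma>_add[of 1 1] by simp

lemma \<sigma>_3 [simp]: "\<sigma> 3 = 3"
  using \<sigma>_add[of 1 2] by simp

context
  fixes s :: complex
  assumes s: "s \<noteq> 0" "s\<^sup>2 \<in> L" "\<sigma> (s\<^sup>2) = s\<^sup>2"
begin

lemma twist_map_Affine [simp]: "twist_map \<sigma> s (Affine x (s * v)) = Affine (\<sigma> x) (s * \<sigma> v)"
  using s(1) by simp

lemma twist_map_twist:
  assumes "P \<in> twist L s"
  shows "twist_map \<sigma> s P \<in> twist L s"
  using assms s(1)
proof (cases rule: twist_cases)
  case P: (2 x v)
  have "Affine x (s * v) \<in> ell" using assms P(1) by (simp add: twist_in_ell)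
  then have eq: "s\<^sup>2 * v\<^sup>2 = x * x\<^sup>2 - x"
    by (simp add: Affine_in_ell power_mult_distrib power3_eq_cube power2_eq_square mult_ac)
  have "\<sigma> (s\<^sup>2 * v\<^sup>2) = \<sigma> (x * x\<^sup>2 - x)" using eq by simp
  then have "s\<^sup>2 * (\<sigma> v)\<^sup>2 = \<sigma> x * (\<sigma> x)\<^sup>2 - \<sigma> x" using P s by simp
  then have "Affine (\<sigma> x) (s * \<sigma> v) \<in> ell"
    by (simp add: Affine_in_ell power_mult_distrib power3_eq_cube power2_eq_square mult_ac)
  then show ?thesis using P s(1) by (simp add: Affine_twist del: twist_map.simps(2))
qed simp

lemma twist_map_involution: "P \<in> twist L s \<Longrightarrow> twist_map \<sigma> s (twist_map \<sigma> s P) = P"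
  using s(1) by (elim twist_cases) (simp_all del: twist_map.simps(2))

lemma twist_map_neg: "P \<in> twist L s \<Longrightarrow> twist_map \<sigma> s (\<boxminus> P) = \<boxminus> (twist_map \<sigma> s P)"
  using s(1) by (elim twist_cases) simp_all

lemma twist_map_add:
  assumes "P \<in> twist L s" "Q \<in> twist L s"
  shows "twist_map \<sigma> s (P \<boxplus> Q) = twist_map \<sigma> s P \<boxplus> twist_map \<sigma> s Q"
  using assms(1) s(1)
proof (cases rule: twist_cases)
  case P: (2 x1 v1)
  show ?thesis
    using assms(2) s(1)
  proof (cases rule: twist_cases)
    case Q: (2 x2 v2)
    have c: "\<sigma> x1 = \<sigma> x2 \<longleftrightarrow> x1 = x2" "\<sigma> v1 + \<sigma> v2 = 0 \<longleftrightarrow> v1 + v2 = 0"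
      using \<sigma>_inj[of x1 x2] \<sigma>_inj[of "v1 + v2" 0] P Q by simp_all
    show ?thesis
      unfolding P(1) Q(1) twist_map_Affine add_twist[OF s(1)] c Let_def
      using P(2,3) Q(2,3) s(2,3) by (simp del: twist_map.simps(2))
  qed (use P in \<open>simp del: twist_map.simps(2)\<close>)
qed simp

lemma twist_map_pow:
  assumes "P \<in> twist L s"
  shows "twist_map \<sigma> s (P [^]\<^bsub>EC\<^esub> (n::nat)) = (twist_map \<sigma> s P) [^]\<^bsub>EC\<^esub> n"
  by (induction n) (simp_all add: twist_map_add assms twist_pow_closed s)

lemma twist_map_torsion:
  assumes "P \<in> twist L s" "P \<in> torsion EC"
  shows "twist_map \<sigma> s P \<in> torsion EC"
proof -
  obtain n :: nat where "n > 0" "P [^]\<^bsub>EC\<^esub> n = Infinity" using assms(2) by (auto simp: torsion_def)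
  moreover from this have "(twist_map \<sigma> s P) [^]\<^bsub>EC\<^esub> n = Infinity"
    using twist_map_pow[OF assms(1), of n] by simp
  moreover have "twist_map \<sigma> s P \<in> ell" using twist_map_twist[OF assms(1)] by (rule twist_in_ell)
  ultimately show ?thesis by (auto simp: torsion_def)
qed

end

end

text \<open>The summands are eigencomponents of the conjugation \<open>\<sigma>\<close>. It fixes
  \<open>Q1\<close>, whose coordinates therefore lie in \<open>L\<close>; it negates
  \<open>Q2\<close>, whose coordinate \<open>v\<close> therefore lies in \<open>r L\<close>, which
  moves the twist from \<open>s\<close> to \<open>s * r\<close>. If \<open>r\<close> is already in
  \<open>L\<close>, both summands are \<open>P\<close> itself, so towers may contain redundant
  steps.\<close>

lemma (in csubfield) twist_split:
  assumes r: "r \<noteq> 0" "r\<^sup>2 \<in> L" and s: "s \<noteq> 0" "s\<^sup>2 \<in> L" and P: "P \<in> twist (adj L r) s"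
  obtains Q1 Q2 where "Q1 \<in> twist L s" "Q2 \<in> twist L (s * r)" "P \<boxplus> P = Q1 \<boxplus> Q2"
    "P \<in> torsion EC \<longrightarrow> Q1 \<in> torsion EC \<and> Q2 \<in> torsion EC"
proof (cases "r \<in> L")
  case True
  then have P: "P \<in> twist L s" using P by (simp add: adj_trivial)
  then have "P \<in> twist L (s * r)"
    using True divide[of _ r] unfolding twist_def divide_divide_eq_left[symmetric] by blast
  then show ?thesis using that[OF P] by blast
next
  case False
  obtain \<sigma> where \<sigma>: "\<And>a b. a \<in> L \<Longrightarrow> b \<in> L \<Longrightarrow> \<sigma> (a + b * r) = a - b * r"
    using adj_conjugation[OF r(2) False] by blast
  interpret M: csubfield "adj L r" by (rule csubfield_adj[OF r(2)])
  have \<sigma>': "\<sigma> (a - b * r) = a + b * r" if "a \<in> L" "b \<in> L" for a b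
    using \<sigma>[of a "- b"] that by simp
  interpret I: csubfield_involution "adj L r" \<sigma>
  proof
    fix x y assume "x \<in> adj L r" "y \<in> adj L r"
    then obtain a b c d where xy: "x = a + b * r" "y = c + d * r"
      and L: "a \<in> L" "b \<in> L" "c \<in> L" "d \<in> L" by (meson adjE)
    have "x - y = (a - c) + (b - d) * r" "x * y = (a * c + b * d * r\<^sup>2) + (a * d + b * c) * r"
      by (simp_all add: xy algebra_simps power2_eq_square)
    then have \<sigma>_xy: "\<sigma> (x - y) = (a - c) - (b - d) * r"
      "\<sigma> (x * y) = (a * c + b * d * r\<^sup>2) - (a * d + b * c) * r"
      using L r(2) \<sigma> by simp_all
    have \<sigma>_x_y: "\<sigma> x = a - b * r" "\<sigma> y = c - d * r" using L \<sigma> xy by simp_all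
    show "\<sigma> (x - y) = \<sigma> x - \<sigma> y" "\<sigma> (x * y) = \<sigma> x * \<sigma> y"
      unfolding \<sigma>_xy \<sigma>_x_y by (simp_all add: algebra_simps power2_eq_square)
  next
    fix x assume "x \<in> adj L r"
    then obtain a b where x: "x = a + b * r" "a \<in> L" "b \<in> L" by (elim adjE)
    then show "\<sigma> (\<sigma> x) = x" using \<sigma> \<sigma>' by simp
    show "\<sigma> x \<in> adj L r" using x \<sigma> adjI[of a L "- b" r] by simp
  qed
  have s': "s\<^sup>2 \<in> adj L r" "\<sigma> (s\<^sup>2) = s\<^sup>2"
    using subset_adj[of r] s(2) \<sigma>[of "s\<^sup>2" 0] by auto
  have fixed: "x \<in> L" if "x \<in> adj L r" "\<sigma> x = x" for x
  proof -
    obtain a b where x: "x = a + b * r" "a \<in> L" "b \<in> L" using \<open>x \<in> adj L r\<close> by (elim adjE)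
    then have "a - b * r = a + b * r" using that(2) \<sigma> by simp
    then have "b = 0" using r(1) by (simp add: algebra_simps)
    then show ?thesis using x by simp
  qed
  have anti: "x / r \<in> L" if "x \<in> adj L r" "\<sigma> x = - x" for x
  proof -
    obtain a b where x: "x = a + b * r" "a \<in> L" "b \<in> L" using \<open>x \<in> adj L r\<close> by (elim adjE)
    then have "a - b * r = - (a + b * r)" using that(2) \<sigma> by simp
    then have "a = 0" by (simp add: algebra_simps)
    then show ?thesis using x r(1) by simp
  qed
  define \<Phi> where "\<Phi> = twist_map \<sigma> s"
  note \<Phi>_simps = I.twist_map_add[OF s(1) s', folded \<Phi>_def] I.twist_map_neg[OF s(1) s', folded \<Phi>_def]
    I.twist_map_twist[OF s(1) s', folded \<Phi>_def] I.twist_map_involution[OF s(1) s', folded \<Phi>_def]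
  define Q1 where "Q1 = P \<boxplus> \<Phi> P"
  define Q2 where "Q2 = P \<boxplus> \<boxminus> (\<Phi> P)"
  have \<Phi>P: "\<Phi> P \<in> twist (adj L r) s" "\<boxminus> (\<Phi> P) \<in> twist (adj L r) s"
    using P \<Phi>_simps(3) M.twist_neg_closed by blast+
  then have Q: "Q1 \<in> twist (adj L r) s" "Q2 \<in> twist (adj L r) s"
    using M.twist_add_closed[OF P _ s(1) s'(1)] by (simp_all add: Q1_def Q2_def)
  note in_ell = P[THEN twist_in_ell] \<Phi>P[THEN twist_in_ell]
  have "\<Phi> Q1 = Q1"
    using P \<Phi>P \<Phi>_simps in_ell add_commute_ell by (simp add: Q1_def)
  have "\<Phi> Q2 = \<boxminus> Q2"
    using P \<Phi>P \<Phi>_simps in_ell add_commute_ell[of "\<boxminus> P" "\<Phi> P"] by (simp add: Q2_def neg_add)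
  have "Q1 \<in> twist L s"
    using Q(1) s(1)
  proof (cases rule: twist_cases)
    case (2 x v)
    then have "\<sigma> x = x" "\<sigma> v = v" using \<open>\<Phi> Q1 = Q1\<close> s(1) by (simp_all add: \<Phi>_def)
    then show ?thesis using 2 fixed Q(1) s(1) by (simp add: Affine_twist)
  qed simp
  moreover have "Q2 \<in> twist L (s * r)"
    using Q(2) s(1)
  proof (cases rule: twist_cases)
    case (2 x v)
    then have "\<sigma> x = x" "s * \<sigma> v = s * - v"
      using \<open>\<Phi> Q2 = \<boxminus> Q2\<close> s(1) by (simp_all add: \<Phi>_def)
    then have "\<sigma> x = x" "\<sigma> v = - v" using s(1) mult_left_cancel by blast+
    then have "x \<in> L" "v / r \<in> L" using 2 fixed anti by auto
    moreover have "Q2 = Affine x (s * r * (v / r))" using 2 r(1) by simp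
    moreover have "Q2 \<in> ell" using Q(2) by (rule twist_in_ell)
    ultimately show ?thesis using r(1) s(1) Affine_twist[of "s * r" x "v / r" L] by simp
  qed simp
  moreover have "P \<boxplus> P = Q1 \<boxplus> Q2"
  proof -
    have "Q1 \<boxplus> Q2 = (P \<boxplus> P) \<boxplus> (\<Phi> P \<boxplus> \<boxminus> (\<Phi> P))"
      using EC.m_ac in_ell by (simp add: Q1_def Q2_def)
    then show ?thesis by simp
  qed
  moreover have "Q1 \<in> torsion EC \<and> Q2 \<in> torsion EC" if "P \<in> torsion EC"
    using I.twist_map_torsion[OF s(1) s' P that] that
    by (simp add: Q1_def Q2_def \<Phi>_def torsion_add torsion_neg)
  ultimately show ?thesis using that by blast
qed

section \<open>Descent down a tower of square roots of rationals\<close>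

definition tower :: "complex set \<Rightarrow> complex list \<Rightarrow> complex set" where
  "tower B rs = foldr (\<lambda>r L. adj L r) rs B"

definition rational_roots :: "complex list \<Rightarrow> bool" where
  "rational_roots rs \<longleftrightarrow> (\<forall>r\<in>set rs. r \<noteq> 0 \<and> r\<^sup>2 \<in> \<rat>)"

lemma tower_simps [simp]: "tower B [] = B" "tower B (r # rs) = adj (tower B rs) r"
  by (simp_all add: tower_def)

lemma tower_append: "tower B (rs @ ts) = tower (tower B ts) rs"
  by (simp add: tower_def)

lemma tower_mono: "B \<subseteq> C \<Longrightarrow> tower B rs \<subseteq> tower C rs"
  by (induction rs) (auto simp: adj_mono)

lemma rational_roots_simps [simp]:
  "rational_roots []"
  "rational_roots (r # rs) \<longleftrightarrow> r \<noteq> 0 \<and> r\<^sup>2 \<in> \<rat> \<and> rational_roots rs"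
  "rational_roots (rs @ ts) \<longleftrightarrow> rational_roots rs \<and> rational_roots ts"
  by (auto simp: rational_roots_def)

lemma csubfield_tower:
  assumes "csubfield B" "rational_roots rs"
  shows "csubfield (tower B rs)"
  using assms(2)
proof (induction rs)
  case (Cons r rs)
  then interpret csubfield "tower B rs" by simp
  show ?case using Cons.prems Rats_subset csubfield_adj by auto
qed (simp add: assms(1))

lemma subset_tower:
  assumes "csubfield B" "rational_roots rs"
  shows "B \<subseteq> tower B rs"
  using assms(2)
proof (induction rs)
  case (Cons r rs)
  then have "csubfield (tower B rs)" using csubfield_tower assms(1) by simp
  then have "tower B rs \<subseteq> tower B (r # rs)" using csubfield.subset_adj by simp
  then show ?case using Cons by auto
qed simp

text \<open>The induction generalises over \<open>s\<close>, since removing the top root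
  \<open>r\<close> leads to the twists by \<open>s\<close> and by \<open>s * r\<close>. Each storey
  costs one doubling; at the bottom the abscissa is rational and one last doubling kills the
  point.\<close>

lemma torsion_tower_power_of_2:
  assumes "rational_roots rs" "s \<noteq> 0" "s\<^sup>2 \<in> \<rat>" "P \<in> twist (tower \<rat> rs) s" "P \<in> torsion EC"
  shows "\<exists>k. P [^]\<^bsub>EC\<^esub> ((2::nat) ^ k) = Infinity"
  using assms
proof (induction rs arbitrary: s P)
  case Nil
  have "P [^]\<^bsub>EC\<^esub> ((2::nat) ^ 1) = P \<boxplus> P"
    using Nil by (simp add: numeral_2_eq_2 torsion_def)
  also have "\<dots> = Infinity"
    using Nil torsion_rational_abscissa by (cases P) (auto simp: add_Affine twist_def)
  finally show ?case by blast
next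
  case (Cons r rs)
  interpret L: csubfield "tower \<rat> rs"
    using Cons.prems csubfield_tower csubfield_Rats by simp
  have sr: "r \<noteq> 0" "r\<^sup>2 \<in> \<rat>" "s \<noteq> 0" "s\<^sup>2 \<in> \<rat>" "s * r \<noteq> 0" "(s * r)\<^sup>2 \<in> \<rat>"
    using Cons.prems by (auto simp: power_mult_distrib)
  have T: "r\<^sup>2 \<in> tower \<rat> rs" "s\<^sup>2 \<in> tower \<rat> rs" "P \<in> twist (adj (tower \<rat> rs) r) s"
    using L.Rats_subset sr Cons.prems by auto
  obtain Q1 Q2 where Q: "Q1 \<in> twist (tower \<rat> rs) s" "Q2 \<in> twist (tower \<rat> rs) (s * r)"
    "P \<boxplus> P = Q1 \<boxplus> Q2" and Q_torsion: "P \<in> torsion EC \<longrightarrow> Q1 \<in> torsion EC \<and> Q2 \<in> torsion EC"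
    using L.twist_split[OF sr(1) T(1) sr(3) T(2,3)] by blast
  have "Q1 \<in> torsion EC" "Q2 \<in> torsion EC" using Q_torsion Cons.prems by auto
  note Q = Q this
  obtain k1 where k1: "Q1 [^]\<^bsub>EC\<^esub> ((2::nat) ^ k1) = Infinity"
    using Cons.IH[of s Q1] Cons.prems Q sr by auto
  obtain k2 where k2: "Q2 [^]\<^bsub>EC\<^esub> ((2::nat) ^ k2) = Infinity"
    using Cons.IH[of "s * r" Q2] Cons.prems Q sr by auto
  have in_ell: "P \<in> ell" "Q1 \<in> ell" "Q2 \<in> ell"
    using Q Cons.prems twist_in_ell by blast+
  have "P [^]\<^bsub>EC\<^esub> ((2::nat) ^ (1 + k1 + k2)) = (P \<boxplus> P) [^]\<^bsub>EC\<^esub> ((2::nat) ^ k1 * 2 ^ k2)"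
    using in_ell EC.nat_pow_pow[of P 2 "2 ^ k1 * 2 ^ k2"]
    by (simp add: numeral_2_eq_2 power_add mult.assoc)
  also have "\<dots> = Q1 [^]\<^bsub>EC\<^esub> ((2::nat) ^ k1 * 2 ^ k2) \<boxplus> Q2 [^]\<^bsub>EC\<^esub> ((2::nat) ^ k2 * 2 ^ k1)"
    unfolding Q(3) using in_ell EC.nat_pow_distrib by (simp add: mult.commute)
  also have "\<dots> = Infinity"
    using in_ell k1 k2 EC.nat_pow_pow[of Q1 "2 ^ k1" "2 ^ k2"] EC.nat_pow_pow[of Q2 "2 ^ k2" "2 ^ k1"]
      EC.nat_pow_one by simp
  finally show ?case by blast
qed

section \<open>All points over Q(i, sqrt 2) are torsion\<close>

lemma rational_twist_two_torsion:
  assumes "P \<in> twist \<rat> s" "s\<^sup>2 \<in> {1, -1, 2, -2}"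
  shows "P \<boxplus> P = Infinity"
proof -
  have "s \<noteq> 0" using assms(2) by auto
  with assms(1) show ?thesis
  proof (cases rule: twist_cases)
    case (2 x v)
    obtain x' v' where xv: "x = of_rat x'" "v = of_rat v'" using 2 by (auto elim!: Rats_cases)
    obtain e :: rat where e: "s\<^sup>2 = of_rat e" "e \<in> {1, -1, 2, -2}"
      using assms(2) by (auto intro: that[of 1] that[of "-1"] that[of 2] that[of "-2"] simp: of_rat_minus)
    have "(s * v)\<^sup>2 = x ^ 3 - x" using 2 assms(1) twist_in_ell by (simp flip: Affine_in_ell)
    then have "(of_rat (x' ^ 3 - x') :: complex) = of_rat (e * v'\<^sup>2)"
      using e(1) xv by (simp add: of_rat_diff of_rat_mult of_rat_power power_mult_distrib)
    then have "v' = 0" using twisted_rational_points[OF e(2), of x' v'] by (simp only: of_rat_eq_iff)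
    then show ?thesis using 2 xv by (simp add: add_Affine)
  qed simp
qed

lemma torsion_halve:
  assumes "P \<in> ell" "P \<boxplus> P \<in> torsion EC"
  shows "P \<in> torsion EC"
proof -
  obtain n :: nat where n: "n > 0" "(P \<boxplus> P) [^]\<^bsub>EC\<^esub> n = Infinity" using assms(2) by (auto simp: torsion_def)
  then have "P [^]\<^bsub>EC\<^esub> (2 * n) = Infinity"
    using EC.nat_pow_pow[of P 2 n] assms(1) by (simp add: numeral_2_eq_2)
  then show ?thesis using n(1) assms(1) by (auto simp: torsion_def intro!: exI[of _ "2 * n"])
qed

abbreviation sqrt2 :: complex where
  "sqrt2 \<equiv> complex_of_real (sqrt 2)"

abbreviation Qi :: "complex set" where
  "Qi \<equiv> adj \<rat> \<i>"

abbreviation Qi_sqrt2 :: "complex set" where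
  "Qi_sqrt2 \<equiv> adj Qi sqrt2"

lemma sqrt2_squared [simp]: "sqrt2\<^sup>2 = 2" "sqrt2 * sqrt2 = 2"
  by (simp_all flip: of_real_power of_real_mult)

lemma csubfield_Qi: "csubfield Qi"
  by (rule csubfield.csubfield_adj[OF csubfield_Rats]) simp

lemma csubfield_Qi_sqrt2: "csubfield Qi_sqrt2"
  by (rule csubfield.csubfield_adj[OF csubfield_Qi]) (simp add: csubfield.numeral[OF csubfield_Qi])

text \<open>Splitting along \<open>\<i>\<close> turns the twist by \<open>s^2\<close> into those by
  \<open>s^2\<close> and \<open>- s^2\<close>. Starting from 1 or 2, only the four twists whose
  rational points are all 2-torsion occur.\<close>

lemma twist_Qi_torsion:
  assumes "P \<in> twist Qi s" "s\<^sup>2 \<in> {1, 2}"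
  shows "P \<in> torsion EC"
proof -
  have s: "s \<noteq> 0" "s\<^sup>2 \<in> \<rat>" using assms(2) by auto
  have i: "\<i> \<noteq> 0" "\<i>\<^sup>2 \<in> \<rat>" by auto
  obtain Q1 Q2 where Q: "Q1 \<in> twist \<rat> s" "Q2 \<in> twist \<rat> (s * \<i>)" "P \<boxplus> P = Q1 \<boxplus> Q2"
    using csubfield.twist_split[OF csubfield_Rats i s assms(1)] by blast
  have "Q1 \<boxplus> Q1 = Infinity"
    using rational_twist_two_torsion[OF Q(1)] assms(2) by auto
  moreover have "Q2 \<boxplus> Q2 = Infinity"
    using rational_twist_two_torsion[OF Q(2)] assms(2) by (auto simp: power_mult_distrib)
  moreover have "Infinity \<in> torsion EC" using EC.nat_pow_one[of 1] by (auto simp: torsion_def intro!: exI[of _ 1])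
  ultimately have "Q1 \<in> torsion EC" "Q2 \<in> torsion EC"
    using torsion_halve Q twist_in_ell by metis+
  then show ?thesis using Q(3) torsion_add torsion_halve assms(1) twist_in_ell by metis
qed

theorem twist_Qi_sqrt2_torsion:
  assumes "P \<in> twist Qi_sqrt2 1"
  shows "P \<in> torsion EC"
proof -
  have s: "(1::complex) \<noteq> 0" "1\<^sup>2 \<in> Qi" "sqrt2 \<noteq> 0" "sqrt2\<^sup>2 \<in> Qi"
    using csubfield.one[OF csubfield_Qi] csubfield.numeral[OF csubfield_Qi] by auto
  obtain Q1 Q2 where Q: "Q1 \<in> twist Qi 1" "Q2 \<in> twist Qi (1 * sqrt2)" "P \<boxplus> P = Q1 \<boxplus> Q2"
    using csubfield.twist_split[OF csubfield_Qi s(3,4,1,2) assms] by blast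
  have "Q1 \<in> torsion EC" using twist_Qi_torsion[OF Q(1)] by simp
  moreover have "Q2 \<in> torsion EC" using twist_Qi_torsion[OF Q(2)] by simp
  ultimately show ?thesis using Q(3) torsion_add torsion_halve assms twist_in_ell by metis
qed

section \<open>Square roots in multi-quadratic fields\<close>

text \<open>Kummer theory in coordinates: for \<open>\<alpha> = a + b * r\<close> with square below,
  the coefficient \<open>2 * a * b\<close> of \<open>r\<close> vanishes, so \<open>\<alpha>\<close>
  drops one storey either at once or after division by \<open>r\<close>. The factor \<open>d\<close>
  collects the rational squares \<open>r^2\<close> divided out on the way.\<close>

lemma tower_square_root:
  assumes "csubfield B" "rational_roots rs" "\<alpha> \<in> tower B rs" "\<alpha>\<^sup>2 \<in> B"
  shows "\<exists>d\<in>\<rat>. \<exists>b\<in>B. \<alpha>\<^sup>2 = d * b\<^sup>2"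
  using assms(2-)
proof (induction rs arbitrary: \<alpha>)
  case Nil
  then show ?case by (intro bexI[of _ 1] bexI[of _ \<alpha>]) auto
next
  case (Cons r rs)
  interpret T: csubfield "tower B rs" using csubfield_tower assms(1) Cons.prems by simp
  have r: "r \<noteq> 0" "r\<^sup>2 \<in> \<rat>" "r\<^sup>2 \<in> tower B rs" using Cons.prems T.Rats_subset by auto
  have \<alpha>2: "\<alpha>\<^sup>2 \<in> tower B rs" using subset_tower[of B rs] assms(1) Cons.prems by auto
  show ?case
  proof (cases "r \<in> tower B rs")
    case True
    then show ?thesis using Cons T.adj_trivial by simp
  next
    case False
    obtain a b where ab: "\<alpha> = a + b * r" "a \<in> tower B rs" "b \<in> tower B rs"
      using Cons.prems by (auto elim: adjE)
    have "(a\<^sup>2 + b\<^sup>2 * r\<^sup>2) + (2 * a * b) * r = \<alpha>\<^sup>2 + 0 * r"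
      unfolding ab(1) by (simp add: power2_eq_square algebra_simps)
    moreover have "a\<^sup>2 + b\<^sup>2 * r\<^sup>2 \<in> tower B rs" "2 * a * b \<in> tower B rs"
      using ab(2,3) r(3) by simp_all
    ultimately have "2 * a * b = 0" by (rule T.adj_unique(2)[OF _ False _ _ \<alpha>2 T.zero])
    then consider "b = 0" | "a = 0" by auto
    then show ?thesis
    proof cases
      case 1
      then show ?thesis using Cons ab by simp
    next
      case 2
      interpret B: csubfield B by (rule assms(1))
      have "b\<^sup>2 = \<alpha>\<^sup>2 / r\<^sup>2" using 2 ab r by (simp add: power_mult_distrib)
      moreover have "\<alpha>\<^sup>2 / r\<^sup>2 \<in> B" using B.divide[of "\<alpha>\<^sup>2" "r\<^sup>2"] B.Rats_subset r Cons.prems by auto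
      ultimately obtain d c where d: "d \<in> \<rat>" "c \<in> B" "b\<^sup>2 = d * c\<^sup>2"
        using Cons.IH[of b] ab Cons.prems by auto
      have "\<alpha>\<^sup>2 = (d * r\<^sup>2) * c\<^sup>2" using 2 ab d by (simp add: power_mult_distrib)
      then show ?thesis using d r by (intro bexI[of _ "d * r\<^sup>2"] bexI[of _ c]) auto
    qed
  qed
qed

lemma rational_square_neq_2:
  fixes q :: real
  assumes "q \<in> \<rat>"
  shows "q\<^sup>2 \<noteq> 2"
proof
  assume q: "q\<^sup>2 = 2"
  obtain m n :: int where mn: "n > 0" "coprime m n" "q = of_int m / of_int n"
    using assms by (rule Rats_cases')
  then have "of_int m = q * of_int n" by simp
  then have "(of_int (m\<^sup>2) :: real) = of_int (2 * n\<^sup>2)" using q by (simp add: power_mult_distrib)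
  then have eq: "m\<^sup>2 = 2 * n\<^sup>2" by (simp only: of_int_eq_iff)
  then have "even m" by (metis dvd_triv_left even_power)
  then obtain k where "m = 2 * k" by (elim evenE)
  then have "n\<^sup>2 = 2 * k\<^sup>2" using eq by (simp add: power_mult_distrib)
  then have "even n" by (metis dvd_triv_left even_power)
  then show False using \<open>even m\<close> mn(2) by (metis coprime_common_divisor odd_one)
qed

lemma Rats_complex_cases:
  assumes "z \<in> \<rat>"
  obtains q :: real where "z = complex_of_real q" "q \<in> \<rat>"
proof -
  obtain a b where "z = of_int a / of_int b" using assms by (rule Rats_cases')
  then have "z = complex_of_real (of_int a / of_int b)" by simp
  then show ?thesis using that by fastforce
qed

lemma Re_Im_Qi:
  assumes "z \<in> Qi"
  shows "Re z \<in> \<rat>" "Im z \<in> \<rat>"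
proof -
  obtain a b where z: "z = a + b * \<i>" "a \<in> \<rat>" "b \<in> \<rat>" using assms by (elim adjE)
  obtain p q where "a = complex_of_real p" "p \<in> \<rat>" "b = complex_of_real q" "q \<in> \<rat>"
    using z(2,3) by (meson Rats_complex_cases)
  then show "Re z \<in> \<rat>" "Im z \<in> \<rat>" using z(1) by simp_all
qed

lemma sqrt2_notin_Qi: "sqrt2 \<notin> Qi"
  using Re_Im_Qi(1)[of sqrt2] rational_square_neq_2[of "sqrt 2"] by auto

lemma Qi_square_neq_minus_2:
  assumes "z \<in> Qi"
  shows "z\<^sup>2 \<noteq> -2"
proof
  assume "z\<^sup>2 = -2"
  then have "(Re z)\<^sup>2 - (Im z)\<^sup>2 = -2" "Re z = 0 \<or> Im z = 0"
    by (auto simp: complex_eq_iff power2_eq_square)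
  moreover have "(Im z)\<^sup>2 \<noteq> 2" using rational_square_neq_2 Re_Im_Qi assms by blast
  moreover have "(Re z)\<^sup>2 \<noteq> -2" using zero_le_power2[of "Re z"] by linarith
  ultimately show False by auto
qed

text \<open>The norm of \<open>1 + e\<close> is 2, so \<open>d\<close> times the norm of
  \<open>z\<close> would be a rational number with square 2.\<close>

lemma Qi_square_neq_1_pm_i:
  assumes "z \<in> Qi" "d \<in> \<rat>" "e \<in> {\<i>, - \<i>}"
  shows "d * z\<^sup>2 \<noteq> 1 + e"
proof
  assume eq: "d * z\<^sup>2 = 1 + e"
  obtain q where q: "d = complex_of_real q" "q \<in> \<rat>" using assms(2) by (rule Rats_complex_cases)
  have "q * ((Re z)\<^sup>2 - (Im z)\<^sup>2) = 1" "2 * q * Re z * Im z = Im e"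
    using eq assms(3) unfolding q(1) by (auto simp: complex_eq_iff power2_eq_square algebra_simps)
  moreover have "(Im e)\<^sup>2 = 1" using assms(3) by auto
  moreover have "(q * ((Re z)\<^sup>2 + (Im z)\<^sup>2))\<^sup>2 =
      (q * ((Re z)\<^sup>2 - (Im z)\<^sup>2))\<^sup>2 + (2 * q * Re z * Im z)\<^sup>2"
    by (simp add: power2_eq_square algebra_simps)
  ultimately have "(q * ((Re z)\<^sup>2 + (Im z)\<^sup>2))\<^sup>2 = 2" by simp
  moreover have "q * ((Re z)\<^sup>2 + (Im z)\<^sup>2) \<in> \<rat>" using q Re_Im_Qi[OF assms(1)] by simp
  ultimately show False using rational_square_neq_2 by blast
qed

text \<open>The base is chosen to contain every candidate for \<open>\<alpha>^2\<close>, namely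
  \<open>sqrt2\<close>, \<open>- sqrt2\<close>, \<open>1 + \<i>\<close> and \<open>1 - \<i>\<close>.
  Then \<open>tower_square_root\<close> brings the question down to the base, and comparing
  coordinates brings it down to \<open>Qi\<close>.\<close>

lemma tower_no_roots:
  assumes "rational_roots rs" "\<alpha> \<in> tower Qi_sqrt2 rs"
  shows "\<alpha> ^ 4 \<noteq> 2" "(\<alpha>\<^sup>2 - 1)\<^sup>2 \<noteq> -1"
proof -
  interpret Qi: csubfield Qi by (rule csubfield_Qi)
  interpret B: csubfield Qi_sqrt2 by (rule csubfield_Qi_sqrt2)
  have split: "\<exists>d p q. d \<in> \<rat> \<and> p \<in> Qi \<and> q \<in> Qi \<and> d * (p\<^sup>2 + 2 * q\<^sup>2) = u \<and> 2 * d * p * q = v"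
    if "\<alpha>\<^sup>2 = u + v * sqrt2" "u \<in> Qi" "v \<in> Qi" for u v
  proof -
    have "\<alpha>\<^sup>2 \<in> Qi_sqrt2" using that adjI by simp
    then obtain d b where d: "d \<in> \<rat>" "b \<in> Qi_sqrt2" "\<alpha>\<^sup>2 = d * b\<^sup>2"
      using tower_square_root[OF csubfield_Qi_sqrt2 assms] by blast
    obtain p q where pq: "b = p + q * sqrt2" "p \<in> Qi" "q \<in> Qi" by (rule adjE[OF d(2)])
    have "d \<in> Qi" using d(1) Qi.Rats_subset by blast
    have "b\<^sup>2 = p\<^sup>2 + 2 * p * q * sqrt2 + q\<^sup>2 * sqrt2\<^sup>2"
      unfolding pq(1) by (simp only: power2_sum power_mult_distrib) (simp add: mult_ac)
    then have "d * (p\<^sup>2 + 2 * q\<^sup>2) + (2 * d * p * q) * sqrt2 = u + v * sqrt2"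
      using d(3) that(1) by (simp add: algebra_simps)
    from Qi.adj_unique[OF this sqrt2_notin_Qi] show ?thesis
      using that(2,3) pq d(1) \<open>d \<in> Qi\<close> by auto
  qed
  show "\<alpha> ^ 4 \<noteq> 2"
  proof
    assume "\<alpha> ^ 4 = 2"
    then have "(\<alpha>\<^sup>2)\<^sup>2 = sqrt2\<^sup>2" by (simp flip: power_mult)
    then have "\<alpha>\<^sup>2 = sqrt2 \<or> \<alpha>\<^sup>2 = - sqrt2" by (simp only: power2_eq_iff)
    then have "\<alpha>\<^sup>2 = 0 + 1 * sqrt2 \<or> \<alpha>\<^sup>2 = 0 + (- 1) * sqrt2" by simp
    then obtain v where "\<alpha>\<^sup>2 = 0 + v * sqrt2" "v \<in> {1, -1}" by blast
    moreover from this(2) have "v \<in> Qi" by auto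
    ultimately obtain d p q where "p \<in> Qi" "q \<in> Qi" "d * (p\<^sup>2 + 2 * q\<^sup>2) = 0" "2 * d * p * q = v"
      using split[of 0 v] by auto
    moreover from this have "d \<noteq> 0" "q \<noteq> 0" using \<open>v \<in> {1, -1}\<close> by auto
    ultimately have "p\<^sup>2 = -2 * q\<^sup>2" "q \<noteq> 0" by (auto simp: eq_neg_iff_add_eq_0)
    then have "(p / q)\<^sup>2 = -2" by (simp add: power_divide)
    then show False using Qi_square_neq_minus_2[of "p / q"] \<open>p \<in> Qi\<close> \<open>q \<in> Qi\<close> by simp
  qed
  show "(\<alpha>\<^sup>2 - 1)\<^sup>2 \<noteq> -1"
  proof
    assume "(\<alpha>\<^sup>2 - 1)\<^sup>2 = -1"
    then have "(\<alpha>\<^sup>2 - 1)\<^sup>2 = \<i>\<^sup>2" by simp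
    then have "\<alpha>\<^sup>2 - 1 = \<i> \<or> \<alpha>\<^sup>2 - 1 = - \<i>" by (simp only: power2_eq_iff)
    then obtain e where e: "\<alpha>\<^sup>2 = 1 + e" "e \<in> {\<i>, - \<i>}" by (metis add_diff_cancel_left' diff_add_cancel insertCI add.commute)
    have "\<i> \<in> Qi" by (rule csubfield.root_in_adj[OF csubfield_Rats])
    then have "e \<in> Qi" using e(2) by auto
    then obtain d p q where d: "d \<in> \<rat>" "p \<in> Qi" "q \<in> Qi" "d * (p\<^sup>2 + 2 * q\<^sup>2) = 1 + e" "2 * d * p * q = 0"
      using split[of "1 + e" 0] e(1) by auto
    \<comment> \<open>In each case \<open>1 + e\<close> becomes a rational multiple of a square in
      \<open>Qi\<close>.\<close>
    then consider "d = 0" | "p = 0" | "q = 0" by auto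
    then show False
    proof cases
      case 1
      then show False using d e(2) Qi_square_neq_1_pm_i[of 0 0 e] by auto
    next
      case 2
      then have "(2 * d) * q\<^sup>2 = 1 + e" using d by (simp add: mult_ac)
      then show False using Qi_square_neq_1_pm_i[of q "2 * d" e] d e(2) by simp
    next
      case 3
      then show False using Qi_square_neq_1_pm_i[of p d e] d e(2) by simp
    qed
  qed
qed

section \<open>Multi-quadratic number fields inside towers of square roots\<close>

lemma complex_field_simps:
  "\<one>\<^bsub>complex_field\<^esub> = 1" "\<zero>\<^bsub>complex_field\<^esub> = 0" "x \<oplus>\<^bsub>complex_field\<^esub> y = x + y"
  "x \<otimes>\<^bsub>complex_field\<^esub> y = x * y" "carrier complex_field = UNIV"
  by (simp_all add: ring_of_type_algebra_def)

lemma cring_complex_field: "cring complex_field"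
  by (rule cring_from_type_algebra)

lemma complex_field_minus: "\<ominus>\<^bsub>complex_field\<^esub> x = - x"
proof -
  interpret CF: cring complex_field by (rule cring_complex_field)
  show ?thesis using CF.minus_equality[of "- x" x] by (simp add: complex_field_simps)
qed

lemma complex_field_inv:
  assumes "x \<noteq> 0"
  shows "inv\<^bsub>complex_field\<^esub> x = inverse x"
proof -
  interpret CF: cring complex_field by (rule cring_complex_field)
  show ?thesis using CF.comm_inv_char[of x "inverse x"] assms by (simp add: complex_field_simps)
qed

lemma csubfield_generate: "csubfield (generate_field complex_field S)"
proof
  let ?G = "generate_field complex_field S"
  show "1 \<in> generate_field complex_field S"
    using generate_field.one[of complex_field S] by (simp add: complex_field_simps)
  show "a - b \<in> ?G" if "a \<in> ?G" "b \<in> ?G" for a b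
    using generate_field.eng_add[OF that(1) generate_field.a_inv[OF that(2)]]
    by (simp add: complex_field_simps complex_field_minus)
  show "a * b \<in> ?G" if "a \<in> ?G" "b \<in> ?G" for a b
    using generate_field.eng_mult[OF that] by (simp add: complex_field_simps)
  show "inverse a \<in> ?G" if "a \<in> ?G" for a
  proof (cases "a = 0")
    case False
    then show ?thesis
      using generate_field.m_inv[OF that] by (simp add: complex_field_simps complex_field_inv)
  qed (use that in simp)
qed

lemma generate_subset_csubfield:
  assumes "csubfield M" "S \<subseteq> M"
  shows "generate_field complex_field S \<subseteq> M"
proof
  interpret csubfield M by fact
  fix z assume "z \<in> generate_field complex_field S"
  then show "z \<in> M"
    by induction (use assms(2) in
      \<open>auto simp: complex_field_simps complex_field_minus complex_field_inv\<close>)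
qed

lemma ring_complex_field: "ring complex_field"
  by (rule ring_from_type_algebra)

lemma dimension_0D: "ring.dimension complex_field 0 F E \<Longrightarrow> E = {0}"
  by (erule ring.dimension.cases[OF ring_complex_field])
    (simp only: complex_field_simps, simp only: nat.distinct)

lemma dimension_SucD:
  assumes "ring.dimension complex_field (Suc n) F E"
  obtains v E' where "ring.dimension complex_field n F E'"
    "\<forall>x\<in>E. \<exists>a\<in>F. \<exists>u\<in>E'. x = a * v + u"
proof -
  have "\<exists>v E'. ring.dimension complex_field n F E' \<and> E = ring.line_extension complex_field F v E'"
    using assms unfolding ring.dimension.simps[OF ring_complex_field, of "Suc n"] by fast
  then obtain v E' where E': "ring.dimension complex_field n F E'"
    and E: "E = ring.line_extension complex_field F v E'" by blast
  have "\<forall>x\<in>E. \<exists>a\<in>F. \<exists>u\<in>E'. x = a * v + u"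
  proof
    fix x assume "x \<in> E"
    then show "\<exists>a\<in>F. \<exists>u\<in>E'. x = a * v + u"
      unfolding E ring.line_extension_mem_iff[OF ring_complex_field] complex_field_simps .
  qed
  then show ?thesis by (rule that[OF E'])
qed

text \<open>\<open>\<alpha> + \<beta> z + \<gamma> z\<^sup>2 = 0\<close> below is the vanishing of the three minors of the coordinates of
  \<open>1, z, z\<^sup>2\<close> in a two-dimensional space.\<close>

lemma quadratic_number_field_element:
  assumes "quadratic_number_field L" "z \<in> L"
  obtains r where "r \<noteq> 0" "r\<^sup>2 \<in> \<rat>" "z \<in> adj \<rat> r"
proof (cases "z \<in> \<rat>")
  case True
  then show ?thesis using that[of 1] csubfield.subset_adj[OF csubfield_Rats] by auto
next
  case False
  have sub: "subring L complex_field" and dim: "ring.dimension complex_field (Suc (Suc 0)) \<rat> L"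
    using assms(1) subfieldE(1) by (auto simp: quadratic_number_field_def numeral_2_eq_2)
  obtain v E where E: "ring.dimension complex_field (Suc 0) \<rat> E" "\<forall>x\<in>L. \<exists>a\<in>\<rat>. \<exists>u\<in>E. x = a * v + u"
    by (rule dimension_SucD[OF dim])
  obtain w E' where E': "ring.dimension complex_field 0 \<rat> E'" "\<forall>x\<in>E. \<exists>b\<in>\<rat>. \<exists>u\<in>E'. x = b * w + u"
    by (rule dimension_SucD[OF E(1)])
  have span: "\<exists>a\<in>\<rat>. \<exists>b\<in>\<rat>. x = a * v + b * w" if x: "x \<in> L" for x
  proof -
    obtain a u where a: "a \<in> \<rat>" "u \<in> E" "x = a * v + u" using bspec[OF E(2) x] by blast
    obtain b u' where b: "b \<in> \<rat>" "u' \<in> E'" "u = b * w + u'" using bspec[OF E'(2) a(2)] by blast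
    have "u' = 0" using b(2) dimension_0D[OF E'(1)] by simp
    then have "x = a * v + b * w" using a(3) b(3) by simp
    then show ?thesis using a(1) b(1) by blast
  qed
  have L: "1 \<in> L" "z\<^sup>2 \<in> L"
    using subringE(3)[OF sub] subringE(6)[OF sub, of z z] assms(2)
    by (simp_all add: complex_field_simps power2_eq_square)
  obtain a b where 1: "a \<in> \<rat>" "b \<in> \<rat>" "1 = a * v + b * w" using span[OF L(1)] by blast
  obtain c d where z: "c \<in> \<rat>" "d \<in> \<rat>" "z = c * v + d * w" using span[OF assms(2)] by blast
  obtain e f where z2: "e \<in> \<rat>" "f \<in> \<rat>" "z\<^sup>2 = e * v + f * w" using span[OF L(2)] by blast
  define \<alpha> \<beta> \<gamma> where "\<alpha> = c * f - d * e" and "\<beta> = b * e - a * f" and "\<gamma> = a * d - b * c"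
  have rat: "\<alpha> \<in> \<rat>" "\<beta> \<in> \<rat>" "\<gamma> \<in> \<rat>" using 1 z z2 by (simp_all add: \<alpha>_def \<beta>_def \<gamma>_def)
  have "\<alpha> * 1 + \<beta> * z + \<gamma> * z\<^sup>2 = 0"
    unfolding 1(3) z2(3) unfolding z(3) \<alpha>_def \<beta>_def \<gamma>_def by (simp add: algebra_simps)
  then have quad: "\<alpha> + \<beta> * z + \<gamma> * z\<^sup>2 = 0" by simp
  \<comment> \<open>Otherwise the coordinate vectors of \<open>1\<close> and \<open>z\<close> are
    proportional and \<open>z\<close> is rational.\<close>
  have "\<gamma> \<noteq> 0"
  proof
    assume "\<gamma> = 0"
    then have "a * z = c * (a * v + b * w)" "b * z = d * (a * v + b * w)"
      unfolding \<gamma>_def z(3) by (simp_all add: algebra_simps)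
    then have az: "a * z = c" "b * z = d" using 1(3) by simp_all
    have "a = 0 \<and> b = 0"
    proof (rule ccontr)
      assume "\<not> (a = 0 \<and> b = 0)"
      then have "z = c / a \<or> z = d / b" using az by (auto simp: eq_divide_eq mult.commute)
      then show False using False 1 z by auto
    qed
    then show False using 1(3) by simp
  qed
  \<comment> \<open>Completing the square: \<open>r^2\<close> is the discriminant of the quadratic
    relation for \<open>z\<close>.\<close>
  define r where "r = 2 * \<gamma> * z + \<beta>"
  have "r\<^sup>2 = \<beta>\<^sup>2 - 4 * \<alpha> * \<gamma> + 4 * \<gamma> * (\<alpha> + \<beta> * z + \<gamma> * z\<^sup>2)"
    by (simp add: r_def power2_eq_square algebra_simps)
  then have "r\<^sup>2 \<in> \<rat>" using quad rat by simp
  have zr: "z = - \<beta> / (2 * \<gamma>) + (1 / (2 * \<gamma>)) * r" using \<open>\<gamma> \<noteq> 0\<close> by (simp add: r_def field_simps)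
  then have "r \<noteq> 0" using False rat by auto
  moreover have "z \<in> adj \<rat> r"
    by (subst zr) (rule adjI, use rat in simp_all)
  ultimately show ?thesis using that \<open>r\<^sup>2 \<in> \<rat>\<close> by blast
qed

text \<open>Concatenating two lists gives a tower containing both, so the union of all towers is a
  field. Once it contains the quadratic fields it contains their compositum, and no list of
  generators of \<open>K\<close> has to be chosen.\<close>

lemma csubfield_towers: "csubfield {z. \<exists>rs. rational_roots rs \<and> z \<in> tower \<rat> rs}" (is "csubfield ?U")
proof -
  have common: "\<exists>rs. rational_roots rs \<and> a \<in> tower \<rat> rs \<and> b \<in> tower \<rat> rs"
    if ab: "a \<in> ?U" "b \<in> ?U" for a b
  proof -
    obtain rs ts where rs: "rational_roots rs" "a \<in> tower \<rat> rs" "rational_roots ts" "b \<in> tower \<rat> ts"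
      using ab by blast
    have "tower \<rat> rs \<subseteq> tower \<rat> (rs @ ts)" unfolding tower_append
      by (rule tower_mono) (rule subset_tower[OF csubfield_Rats rs(3)])
    moreover have "tower \<rat> ts \<subseteq> tower \<rat> (rs @ ts)" unfolding tower_append
      by (rule subset_tower[OF csubfield_tower[OF csubfield_Rats rs(3)] rs(1)])
    ultimately show ?thesis using rs by (intro exI[of _ "rs @ ts"]) auto
  qed
  show ?thesis
  proof
    show "1 \<in> ?U" by (auto intro: exI[of _ "[]"])
    show "a - b \<in> ?U" "a * b \<in> ?U" if ab: "a \<in> ?U" "b \<in> ?U" for a b
    proof -
      obtain rs where rs: "rational_roots rs" "a \<in> tower \<rat> rs" "b \<in> tower \<rat> rs"
        using common[OF ab] by blast
      interpret csubfield "tower \<rat> rs" by (rule csubfield_tower[OF csubfield_Rats rs(1)])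
      show "a - b \<in> ?U" "a * b \<in> ?U" using rs diff mult by blast+
    qed
    show "inverse a \<in> ?U" if a: "a \<in> ?U" for a
    proof -
      obtain rs where rs: "rational_roots rs" "a \<in> tower \<rat> rs" using a by blast
      interpret csubfield "tower \<rat> rs" by (rule csubfield_tower[OF csubfield_Rats rs(1)])
      show "inverse a \<in> ?U" using rs inverse by blast
    qed
  qed
qed

text \<open>Two elements are handled together because both coordinates of a point must lie in the
  same tower.\<close>

lemma multi_quadratic_tower:
  assumes "multi_quadratic_number_field K" "x \<in> K" "y \<in> K"
  obtains rs where "rational_roots rs" "x \<in> tower \<rat> rs" "y \<in> tower \<rat> rs"
proof -
  let ?U = "{z. \<exists>rs. rational_roots rs \<and> z \<in> tower \<rat> rs}"
  obtain F where F: "\<forall>L\<in>F. quadratic_number_field L" "K = generate_field complex_field (\<Union>F)"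
    using assms(1) by (auto simp: multi_quadratic_number_field_def compositum_def)
  have "\<Union>F \<subseteq> ?U"
  proof
    fix z assume "z \<in> \<Union>F"
    then obtain r where "r \<noteq> 0" "r\<^sup>2 \<in> \<rat>" "z \<in> adj \<rat> r"
      using F(1) quadratic_number_field_element by blast
    then show "z \<in> ?U" by (auto intro!: exI[of _ "[r]"])
  qed
  then have "K \<subseteq> ?U" unfolding F(2) by (rule generate_subset_csubfield[OF csubfield_towers])
  then obtain rs ts where rs: "rational_roots rs" "x \<in> tower \<rat> rs" "rational_roots ts" "y \<in> tower \<rat> ts"
    using assms(2,3) by blast
  have "tower \<rat> rs \<subseteq> tower \<rat> (rs @ ts)" unfolding tower_append
    by (rule tower_mono) (rule subset_tower[OF csubfield_Rats rs(3)])
  moreover have "tower \<rat> ts \<subseteq> tower \<rat> (rs @ ts)" unfolding tower_append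
    by (rule subset_tower[OF csubfield_tower[OF csubfield_Rats rs(3)] rs(1)])
  ultimately show ?thesis using that[of "rs @ ts"] rs by auto
qed

lemma csubfield_multi_quadratic:
  assumes "multi_quadratic_number_field K"
  shows "csubfield K"
  using assms csubfield_generate by (auto simp: multi_quadratic_number_field_def compositum_def)

section \<open>The torsion subgroup\<close>

lemma residue_eq:
  fixes x y r :: nat
  assumes "x < r" "y < r" "(x + (r - y)) mod r = 0"
  shows "x = y"
proof (cases "x < y")
  case True
  then have "x + (r - y) < r" "x + (r - y) > 0" using assms by linarith+
  then show ?thesis using assms(3) mod_less[of "x + (r - y)" r] by linarith
next
  case False
  then have eq: "x + (r - y) = (x - y) + r" using assms by linarith
  have "(x - y) mod r = 0" using assms(3) unfolding eq by (simp only: mod_add_self2)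
  moreover have "x - y < r" using assms(1) by linarith
  ultimately show ?thesis using False mod_less[of "x - y" r] by linarith
qed

lemma (in comm_group) iso_two_generators:
  fixes p q :: nat
  assumes c: "c \<in> carrier G" "c [^] p = \<one>" "p > 0" and a: "a \<in> carrier G" "a [^] q = \<one>" "q > 0"
    and indep: "\<And>m n. m < p \<Longrightarrow> n < q \<Longrightarrow> c [^] m \<otimes> a [^] n = \<one> \<Longrightarrow> m = 0 \<and> n = 0"
    and H: "H = {c [^] (m::nat) \<otimes> a [^] (n::nat) | m n. True}"
  shows "G\<lparr>carrier := H\<rparr> \<cong> integer_mod_group p \<times>\<times> integer_mod_group q"
proof -
  have pow_mod: "x [^] (k mod r) = x [^] k" if "x \<in> carrier G" "x [^] r = \<one>" for x and k r :: nat
  proof -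
    have "x [^] k = x [^] (r * (k div r) + k mod r)" by simp
    also have "\<dots> = (x [^] r) [^] (k div r) \<otimes> x [^] (k mod r)"
      using that(1) by (simp only: nat_pow_mult nat_pow_pow)
    finally show ?thesis using that by simp
  qed
  define f where "f = (\<lambda>(i, j). c [^] nat i \<otimes> a [^] nat j)"
  let ?Z = "integer_mod_group p \<times>\<times> integer_mod_group q"
  have car: "carrier ?Z = {0..<int p} \<times> {0..<int q}"
    using c(3) a(3) by (simp add: DirProd_def carrier_integer_mod_group)
  have "f \<in> hom ?Z (G\<lparr>carrier := H\<rparr>)"
  proof (rule homI)
    fix z assume "z \<in> carrier ?Z"
    then show "f z \<in> carrier (G\<lparr>carrier := H\<rparr>)" by (auto simp: H f_def split: prod.splits)
  next
    fix y z assume yz: "y \<in> carrier ?Z" "z \<in> carrier ?Z"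
    obtain i j k l where eq: "y = (i, j)" "z = (k, l)" by (cases y; cases z)
    have pos: "0 \<le> i" "0 \<le> j" "0 \<le> k" "0 \<le> l" using yz unfolding car eq by auto
    have "nat ((i + k) mod int p) = (nat i + nat k) mod p"
      using pos c(3) by (simp add: nat_mod_distrib nat_add_distrib)
    moreover have "nat ((j + l) mod int q) = (nat j + nat l) mod q"
      using pos a(3) by (simp add: nat_mod_distrib nat_add_distrib)
    ultimately have "f (y \<otimes>\<^bsub>?Z\<^esub> z) = c [^] (nat i + nat k) \<otimes> a [^] (nat j + nat l)"
      using pow_mod[OF c(1,2)] pow_mod[OF a(1,2)] by (simp add: eq f_def)
    also have "\<dots> = f y \<otimes> f z"
      using c(1) a(1) by (simp add: eq f_def m_ac flip: nat_pow_mult)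
    finally show "f (y \<otimes>\<^bsub>?Z\<^esub> z) = f y \<otimes>\<^bsub>G\<lparr>carrier := H\<rparr>\<^esub> f z" by simp
  qed
  moreover have "bij_betw f (carrier ?Z) H"
    unfolding bij_betw_def
  proof
    have cancel: "m = m' \<and> n = n'"
      if lt: "m < p" "m' < p" "n < q" "n' < q" and eq: "c [^] m \<otimes> a [^] n = c [^] m' \<otimes> a [^] n'"
      for m m' n n' :: nat
    proof -
      \<comment> \<open>Exponents are subtracted by adding \<open>p - m'\<close> and
        \<open>q - n'\<close>, reduced so that \<open>indep\<close> applies.\<close>
      have "c [^] ((m + (p - m')) mod p) \<otimes> a [^] ((n + (q - n')) mod q)
          = (c [^] m \<otimes> a [^] n) \<otimes> (c [^] (p - m') \<otimes> a [^] (q - n'))"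
        using c(1) a(1) pow_mod[OF c(1,2)] pow_mod[OF a(1,2)] by (simp add: m_ac flip: nat_pow_mult)
      also have "\<dots> = c [^] (m' + (p - m')) \<otimes> a [^] (n' + (q - n'))"
        unfolding eq using c(1) a(1) by (simp add: m_ac flip: nat_pow_mult)
      also have "\<dots> = \<one>" using lt c(2) a(2) by simp
      finally have indices: "(m + (p - m')) mod p = 0 \<and> (n + (q - n')) mod q = 0"
        by (intro indep) (use c(3) a(3) in simp_all)
      show ?thesis
        by (intro conjI residue_eq[OF lt(1,2)] residue_eq[OF lt(3,4)]
            conjunct1[OF indices] conjunct2[OF indices])
    qed
    show "inj_on f (carrier ?Z)"
    proof (rule inj_onI)
      fix y z assume yz: "y \<in> carrier ?Z" "z \<in> carrier ?Z" "f y = f z"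
      obtain i j k l where eq: "y = (i, j)" "z = (k, l)" by (cases y; cases z)
      have bounds: "0 \<le> i" "i < int p" "0 \<le> j" "j < int q" "0 \<le> k" "k < int p" "0 \<le> l" "l < int q"
        using yz(1,2) unfolding car eq by auto
      have "nat i = nat k \<and> nat j = nat l"
        by (rule cancel) (use yz(3) bounds in \<open>auto simp: eq f_def nat_less_iff\<close>)
      then show "y = z" using bounds eq by (simp add: eq_nat_nat_iff)
    qed
    show "f ` carrier ?Z = H"
    proof (intro equalityI subsetI)
      fix h assume "h \<in> H"
      then obtain m n :: nat where "h = c [^] m \<otimes> a [^] n" by (auto simp: H)
      then have "h = f (int (m mod p), int (n mod q))"
        using pow_mod[OF c(1,2)] pow_mod[OF a(1,2)] by (simp add: f_def)
      moreover have "(int (m mod p), int (n mod q)) \<in> carrier ?Z" unfolding car using c(3) a(3) by simp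
      ultimately show "h \<in> f ` carrier ?Z" by blast
    qed (auto simp: H f_def)
  qed
  ultimately have "f \<in> Group.iso ?Z (G\<lparr>carrier := H\<rparr>)" by (simp add: Group.iso_def)
  then have "?Z \<cong> G\<lparr>carrier := H\<rparr>" by (auto simp: is_iso_def)
  moreover have "group ?Z" by (intro DirProd_group group_integer_mod_group)
  ultimately show ?thesis by (rule group.iso_sym[rotated])
qed

section \<open>The 4-torsion points and what they generate\<close>

abbreviation pt_A :: "complex curve_point" where
  "pt_A \<equiv> Affine \<i> (1 - \<i>)"

text \<open>The abscissae of \<open>pt_A\<close> and \<open>pt_B\<close> solve the halving equations
  \<open>t^2 = -1\<close> and \<open>(t - 1)^2 = 2\<close>: the points are halves of
  \<open>(0, 0)\<close> and \<open>(1, 0)\<close>, which generate the 2-torsion.\<close>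

abbreviation pt_B :: "complex curve_point" where
  "pt_B \<equiv> Affine (1 + sqrt2) (2 + sqrt2)"

lemma pt_A_ell: "pt_A \<in> ell"
  by (simp add: Affine_in_ell power2_eq_square power3_eq_cube algebra_simps)

lemma pt_B_ell: "pt_B \<in> ell"
  by (simp add: Affine_in_ell power2_eq_square power3_eq_cube algebra_simps)

lemma two_torsion_ell: "Affine 0 0 \<in> ell" "Affine 1 0 \<in> ell" "Affine (-1) 0 \<in> ell"
  by (simp_all add: Affine_in_ell)

lemma double_pt_A: "pt_A \<boxplus> pt_A = Affine 0 0"
proof -
  have "line_meets (- (1 + \<i>)) 0 \<i> \<i> 0"
    by (simp add: line_meets_def power2_eq_square algebra_simps)
  from add_affine_lineI[OF this] show ?thesis by (simp add: algebra_simps complex_eq_iff)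
qed

lemma double_pt_B: "pt_B \<boxplus> pt_B = Affine 1 0"
proof -
  have l: "line_meets (1 + sqrt2) (- (1 + sqrt2)) (1 + sqrt2) (1 + sqrt2) 1"
    by (simp add: line_meets_def power2_eq_square algebra_simps)
  have y: "(1 + sqrt2) * (1 + sqrt2) + - (1 + sqrt2) = 2 + sqrt2" by (simp add: algebra_simps)
  have "2 + sqrt2 \<noteq> 0"
  proof
    assume "2 + sqrt2 = 0"
    then have "Re (2 + sqrt2) = 0" by (simp only: zero_complex.sel)
    moreover have "sqrt 2 \<ge> 0" by simp
    ultimately show False by (simp add: add_eq_0_iff)
  qed
  then have "(2 + sqrt2) + (2 + sqrt2) \<noteq> 0" by (metis mult_2 mult_eq_0_iff zero_neq_numeral)
  then show ?thesis using add_affine_lineI[OF l, unfolded y] by simp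
qed

lemma add_two_torsion: "Affine 0 0 \<boxplus> Affine 1 0 = Affine (-1) 0"
proof -
  have "line_meets 0 0 0 1 (-1)" by (simp add: line_meets_def)
  from add_affine_lineI[OF this] show ?thesis by simp
qed

lemma two_torsion_cases:
  assumes "P \<in> ell" "P \<boxplus> P = Infinity"
  shows "P \<in> {Infinity, Affine 0 0, Affine 1 0, Affine (-1) 0}"
proof (cases P)
  case (Affine x y)
  then have "y = 0" using assms(2) by (simp add: add_eq_Infinity_iff)
  then have "x ^ 3 - x = 0" using assms(1) Affine by (simp add: Affine_in_ell)
  then have "x * (x - 1) * (x + 1) = 0" by (simp add: power3_eq_cube algebra_simps)
  then show ?thesis using Affine \<open>y = 0\<close> by (auto simp: eq_neg_iff_add_eq_0)
qed simp

lemma add_swap_ell: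
  assumes "P \<in> ell" "Q \<in> ell" "R \<in> ell" "S \<in> ell"
  shows "(P \<boxplus> Q) \<boxplus> (R \<boxplus> S) = (P \<boxplus> R) \<boxplus> (Q \<boxplus> S)"
  using EC.m_ac assms by simp

text \<open>With natural exponents this is the generated subgroup as soon as both points are
  torsion, as are \<open>pt_A\<close>, \<open>pt_B\<close> and \<open>(1, 0)\<close>.\<close>

definition spanned :: "complex curve_point \<Rightarrow> complex curve_point \<Rightarrow> complex curve_point set" where
  "spanned P Q = {P [^]\<^bsub>EC\<^esub> (m::nat) \<boxplus> Q [^]\<^bsub>EC\<^esub> (n::nat) | m n. True}"

lemma spanned_gens:
  assumes "P \<in> ell" "Q \<in> ell"
  shows "Infinity \<in> spanned P Q" "P \<in> spanned P Q" "Q \<in> spanned P Q"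
proof -
  have "P [^]\<^bsub>EC\<^esub> m \<boxplus> Q [^]\<^bsub>EC\<^esub> n \<in> spanned P Q" for m n :: nat
    by (auto simp: spanned_def)
  from this[of 0 0] this[of 1 0] this[of 0 1]
  show "Infinity \<in> spanned P Q" "P \<in> spanned P Q" "Q \<in> spanned P Q"
    using assms by simp_all
qed

lemma spanned_add:
  assumes "P \<in> ell" "Q \<in> ell" "S \<in> spanned P Q" "T \<in> spanned P Q"
  shows "S \<boxplus> T \<in> spanned P Q"
proof -
  obtain m n k l :: nat where ST: "S = P [^]\<^bsub>EC\<^esub> m \<boxplus> Q [^]\<^bsub>EC\<^esub> n" "T = P [^]\<^bsub>EC\<^esub> k \<boxplus> Q [^]\<^bsub>EC\<^esub> l"
    using assms(3,4) unfolding spanned_def by blast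
  have pow_ell: "P [^]\<^bsub>EC\<^esub> i \<in> ell" "Q [^]\<^bsub>EC\<^esub> i \<in> ell" for i :: nat
    using EC.nat_pow_closed[of P i] EC.nat_pow_closed[of Q i] assms(1,2) by simp_all
  have "S \<boxplus> T = (P [^]\<^bsub>EC\<^esub> m \<boxplus> P [^]\<^bsub>EC\<^esub> k) \<boxplus> (Q [^]\<^bsub>EC\<^esub> n \<boxplus> Q [^]\<^bsub>EC\<^esub> l)"
    unfolding ST by (rule add_swap_ell) (rule pow_ell)+
  also have "\<dots> = P [^]\<^bsub>EC\<^esub> (m + k) \<boxplus> Q [^]\<^bsub>EC\<^esub> (n + l)"
    using EC.nat_pow_mult[of P m k] EC.nat_pow_mult[of Q n l] assms(1,2) by simp
  finally show ?thesis unfolding spanned_def by blast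
qed

lemma (in csubfield) spanned_subset_twist:
  assumes "P \<in> twist L 1" "Q \<in> twist L 1"
  shows "spanned P Q \<subseteq> twist L 1"
  using assms twist_pow_closed twist_add_closed by (auto simp: spanned_def)

text \<open>Two halves of the same point differ by a 2-torsion point.\<close>

lemma spanned_halves:
  assumes "P \<in> ell" "Q \<in> ell" "R \<in> ell" "T \<in> spanned P Q" "R \<boxplus> R = T \<boxplus> T"
    and "{Affine 0 0, Affine 1 0, Affine (-1) 0} \<subseteq> spanned P Q"
  shows "R \<in> spanned P Q"
proof -
  have T: "T \<in> ell" using assms(1,2,4) EC.nat_pow_closed by (auto simp: spanned_def)
  then have nT: "\<boxminus> T \<in> ell" by simp
  define D where "D = R \<boxplus> \<boxminus> T"
  have D: "D \<in> ell" using assms(3) nT by (simp add: D_def)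
  have "D \<boxplus> D = (R \<boxplus> R) \<boxplus> \<boxminus> (T \<boxplus> T)"
    unfolding D_def neg_add by (intro add_swap_ell assms(3) nT)
  then have "D \<boxplus> D = Infinity" unfolding assms(5) by simp
  then have "D \<in> spanned P Q"
    using two_torsion_cases[OF D] assms(6) spanned_gens(1)[OF assms(1,2)] by auto
  moreover have "R = D \<boxplus> T" using add_diff_cancel_ell[OF assms(3) nT] by (simp add: D_def)
  ultimately show ?thesis using spanned_add assms(1,2,4) by simp
qed

lemma two_torsion_spanned:
  assumes "P \<in> ell" "Q \<in> ell" "Affine 0 0 \<in> spanned P Q" "Affine 1 0 \<in> spanned P Q"
  shows "{Affine 0 0, Affine 1 0, Affine (-1) 0} \<subseteq> spanned P Q"
  using spanned_add[OF assms] add_two_torsion assms(3,4) by simp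

lemma pow_2_4:
  assumes "P \<in> ell"
  shows "P [^]\<^bsub>EC\<^esub> (2::nat) = P \<boxplus> P" "P [^]\<^bsub>EC\<^esub> (4::nat) = (P \<boxplus> P) \<boxplus> (P \<boxplus> P)"
proof -
  show 2: "P [^]\<^bsub>EC\<^esub> (2::nat) = P \<boxplus> P" using assms by (simp add: numeral_2_eq_2)
  show "P [^]\<^bsub>EC\<^esub> (4::nat) = (P \<boxplus> P) \<boxplus> (P \<boxplus> P)"
    using EC.nat_pow_mult[of P 2 2] assms 2 by simp
qed

text \<open>Every 2-torsion point is the double of one of \<open>Infinity\<close>,
  \<open>pt_A\<close>, \<open>pt_B\<close>, \<open>pt_B \<boxplus> pt_A\<close>. So the double of
  \<open>R\<close> is also the double of a point in the span.\<close>

lemma four_torsion_spanned: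
  assumes "R \<in> ell" "R [^]\<^bsub>EC\<^esub> (4::nat) = Infinity"
  shows "R \<in> spanned pt_B pt_A"
proof -
  note AB = pt_B_ell pt_A_ell
  note gens = spanned_gens[OF AB] and add = spanned_add[OF AB]
  have "Affine 0 0 \<in> spanned pt_B pt_A" "Affine 1 0 \<in> spanned pt_B pt_A"
    using add[OF gens(2) gens(2)] add[OF gens(3) gens(3)] double_pt_A double_pt_B by simp_all
  note sub = two_torsion_spanned[OF AB this]
  have BA: "(pt_B \<boxplus> pt_A) \<boxplus> (pt_B \<boxplus> pt_A) = Affine (-1) 0"
  proof -
    have "(pt_B \<boxplus> pt_A) \<boxplus> (pt_B \<boxplus> pt_A) = (pt_A \<boxplus> pt_A) \<boxplus> (pt_B \<boxplus> pt_B)"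
      using add_swap_ell[OF AB AB] add_commute_ell AB by simp
    then show ?thesis by (simp only: double_pt_A double_pt_B add_two_torsion)
  qed
  have "(R \<boxplus> R) \<boxplus> (R \<boxplus> R) = Infinity" using assms pow_2_4 by simp
  then have "R \<boxplus> R \<in> {Infinity, Affine 0 0, Affine 1 0, Affine (-1) 0}"
    using two_torsion_cases assms(1) by simp
  then obtain T where "T \<in> spanned pt_B pt_A" "R \<boxplus> R = T \<boxplus> T"
    using gens add[OF gens(2,3)] BA double_pt_A double_pt_B by (metis insertE singletonD point_add.simps(1))
  then show ?thesis using spanned_halves[OF AB assms(1) _ _ sub] by blast
qed

text \<open>By the duplication formulas the abscissa of the double minus \<open>e\<close> is a
  square whose numerator is the stated quadratic in \<open>t\<close>, so that numerator
  vanishes.\<close>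

lemma halves_of_two_torsion:
  assumes "Affine t u \<in> ell" "Affine t u \<boxplus> Affine t u = Affine e v"
  shows "e = 0 \<Longrightarrow> t\<^sup>2 = -1" "e = 1 \<Longrightarrow> (t - 1)\<^sup>2 = 2" "e = -1 \<Longrightarrow> (t + 1)\<^sup>2 = 2"
proof -
  have u: "u \<noteq> 0" using assms(2) by (auto simp: add_Affine)
  have e: "e = ((t\<^sup>2 + 1) / (2 * u))\<^sup>2" using double_Affine[OF assms(1) u] assms(2) by auto
  note shift = double_abscissa_shift[OF assms(1) u, folded e]
  show "t\<^sup>2 = -1" if "e = 0"
    using e u that by (simp add: eq_neg_iff_add_eq_0)
  show "(t - 1)\<^sup>2 = 2" if "e = 1"
  proof -
    have "t\<^sup>2 - 2 * t - 1 = 0" using shift(1) u that by simp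
    then show ?thesis by (simp add: power2_eq_square algebra_simps)
  qed
  show "(t + 1)\<^sup>2 = 2" if "e = -1"
  proof -
    have "t\<^sup>2 + 2 * t - 1 = 0" using shift(2) u that by simp
    then show ?thesis by (simp add: power2_eq_square algebra_simps)
  qed
qed

text \<open>As \<open>T\<close> is a double over \<open>L\<close>, its abscissa has
  \<open>t - 1 = \<alpha>^2\<close> and \<open>t + 1 = \<beta>^2\<close> with both roots in
  \<open>L\<close>. If \<open>T\<close> had order 4, the halving equation for \<open>t\<close> would
  become one of the two equations excluded by \<open>roots\<close>.\<close>

lemma (in csubfield) no_point_of_order_8:
  assumes roots: "\<And>\<alpha>. \<alpha> \<in> L \<Longrightarrow> \<alpha> ^ 4 \<noteq> 2 \<and> (\<alpha>\<^sup>2 - 1)\<^sup>2 \<noteq> -1"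
    and Q: "Q \<in> twist L 1" and T: "T = Q \<boxplus> Q" and T4: "(T \<boxplus> T) \<boxplus> (T \<boxplus> T) = Infinity"
  shows "T \<boxplus> T = Infinity"
proof (rule ccontr)
  assume ne: "T \<boxplus> T \<noteq> Infinity"
  have Q_ell: "Q \<in> ell" using Q by (rule twist_in_ell)
  then have T_ell: "T \<in> ell" "T \<boxplus> T \<in> ell" unfolding T by simp_all
  obtain t u where t: "T = Affine t u" using ne by (cases T) auto
  have "T \<boxplus> T \<in> {Infinity, Affine 0 0, Affine 1 0, Affine (-1) 0}"
    by (rule two_torsion_cases[OF T_ell(2) T4])
  then obtain e where e: "Affine t u \<boxplus> Affine t u = Affine e 0" "e \<in> {0, 1, -1}" using ne t by auto
  obtain x y where xy: "Q = Affine x y" "x \<in> L" "y \<in> L"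
    using t T Q by (cases Q) (auto simp: twist_def)
  have y: "y \<noteq> 0" using t unfolding T xy(1) by (auto simp: add_Affine)
  have in_ell: "Affine x y \<in> ell" "Affine t u \<in> ell" using Q_ell T_ell xy(1) t by simp_all
  have t_eq: "t = ((x\<^sup>2 + 1) / (2 * y))\<^sup>2"
    using double_Affine[OF in_ell(1) y] t unfolding T xy(1) by auto
  note shift = double_abscissa_shift[OF in_ell(1) y, folded t_eq]
  define \<alpha> \<beta> where "\<alpha> = (x\<^sup>2 - 2 * x - 1) / (2 * y)" and "\<beta> = (x\<^sup>2 + 2 * x - 1) / (2 * y)"
  have L: "\<alpha> \<in> L" "\<beta> \<in> L" using xy by (simp_all add: \<alpha>_def \<beta>_def)
  have \<alpha>: "t - 1 = \<alpha>\<^sup>2" and \<beta>: "t + 1 = \<beta>\<^sup>2" using shift by (simp_all add: \<alpha>_def \<beta>_def)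
  from e(2) consider "e = 0" | "e = 1" | "e = -1" by blast
  then show False
  proof cases
    case 1
    have "t = \<beta>\<^sup>2 - 1" using \<beta> by (simp add: eq_diff_eq)
    then have "(\<beta>\<^sup>2 - 1)\<^sup>2 = -1" using halves_of_two_torsion(1)[OF in_ell(2) e(1) 1] by simp
    then show False using roots L by blast
  next
    case 2
    then have "\<alpha> ^ 4 = 2" using halves_of_two_torsion(2)[OF in_ell(2) e(1)] \<alpha> by (simp flip: power_mult)
    then show False using roots L by blast
  next
    case 3
    then have "\<beta> ^ 4 = 2" using halves_of_two_torsion(3)[OF in_ell(2) e(1)] \<beta> by (simp flip: power_mult)
    then show False using roots L by blast
  qed
qed

text \<open>The induction hypothesis for the double of \<open>Q\<close> only shows that 8 kills
  \<open>Q\<close>; excluding order 8 lowers this to 4 again.\<close>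

lemma (in csubfield) two_power_torsion_killed_by_4:
  assumes roots: "\<And>\<alpha>. \<alpha> \<in> L \<Longrightarrow> \<alpha> ^ 4 \<noteq> 2 \<and> (\<alpha>\<^sup>2 - 1)\<^sup>2 \<noteq> -1"
    and "Q \<in> twist L 1" "Q [^]\<^bsub>EC\<^esub> ((2::nat) ^ k) = Infinity"
  shows "(Q \<boxplus> Q) \<boxplus> (Q \<boxplus> Q) = Infinity"
  using assms(2,3)
proof (induction k arbitrary: Q)
  case 0
  then have "Q = Infinity" using EC.nat_pow_eone[of Q] twist_in_ell[of Q] by simp
  then show ?case by simp
next
  case (Suc k)
  have Q: "Q \<in> ell" using Suc.prems(1) by (rule twist_in_ell)
  have "(Q \<boxplus> Q) [^]\<^bsub>EC\<^esub> ((2::nat) ^ k) = Infinity"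
    using EC.nat_pow_pow[of Q 2 "2 ^ k"] Suc.prems(2) Q pow_2_4(1)[OF Q] by simp
  moreover have "Q \<boxplus> Q \<in> twist L 1" using twist_add_closed Suc.prems(1) by simp
  ultimately have "(Q \<boxplus> Q \<boxplus> (Q \<boxplus> Q)) \<boxplus> (Q \<boxplus> Q \<boxplus> (Q \<boxplus> Q)) = Infinity" using Suc.IH by blast
  then show ?case using no_point_of_order_8[OF roots Suc.prems(1) refl] by blast
qed

text \<open>Enlarging the base of the tower from the rationals to \<open>Qi_sqrt2\<close> brings the
  element within reach of \<open>tower_no_roots\<close>.\<close>

lemma multi_quadratic_roots:
  assumes "multi_quadratic_number_field K" "\<alpha> \<in> K"
  shows "\<alpha> ^ 4 \<noteq> 2 \<and> (\<alpha>\<^sup>2 - 1)\<^sup>2 \<noteq> -1"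
proof -
  obtain rs where rs: "rational_roots rs" "\<alpha> \<in> tower \<rat> rs"
    using multi_quadratic_tower[OF assms(1) assms(2) assms(2)] by blast
  have "tower \<rat> rs \<subseteq> tower Qi_sqrt2 rs"
    by (rule tower_mono) (rule csubfield.Rats_subset[OF csubfield_Qi_sqrt2])
  then show ?thesis using tower_no_roots[OF rs(1)] rs(2) by blast
qed

lemma multi_quadratic_torsion:
  assumes K: "multi_quadratic_number_field K" and P: "P \<in> twist K 1" "P \<in> torsion EC"
  shows "(P \<boxplus> P) \<boxplus> (P \<boxplus> P) = Infinity"
proof -
  interpret csubfield K by (rule csubfield_multi_quadratic[OF K])
  have "\<exists>rs. rational_roots rs \<and> P \<in> twist (tower \<rat> rs) 1"
  proof (cases P)
    case Infinity
    then show ?thesis by (auto intro!: exI[of _ "[]"])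
  next
    case (Affine x y)
    then have "x \<in> K" "y \<in> K" using P(1) by (auto simp: twist_def)
    then obtain rs where "rational_roots rs" "x \<in> tower \<rat> rs" "y \<in> tower \<rat> rs"
      using multi_quadratic_tower[OF K] by blast
    then show ?thesis using Affine P(1) by (auto simp: twist_def)
  qed
  then obtain k where "P [^]\<^bsub>EC\<^esub> ((2::nat) ^ k) = Infinity"
    using torsion_tower_power_of_2[of _ 1 P] P(2) by auto
  then show ?thesis using two_power_torsion_killed_by_4 multi_quadratic_roots[OF K] P(1) by blast
qed

section \<open>The torsion of J_1(4,8) over K\<close>

lemma carrier_J1_4_8: "carrier (J1_4_8 K) = twist K 1"
proof -
  have "coords_in K P \<longleftrightarrow> (\<forall>x y. P = Affine x y \<longrightarrow> x \<in> K \<and> y / 1 \<in> K)" for P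
    by (cases P) auto
  then show ?thesis by (auto simp: J1_4_8_def point_group_def twist_def ell_def)
qed

lemma torsion_J1_4_8: "torsion (J1_4_8 K) = twist K 1 \<inter> torsion EC"
proof -
  have pow: "P [^]\<^bsub>J1_4_8 K\<^esub> (n::nat) = P [^]\<^bsub>EC\<^esub> n" for P n
    by (simp add: nat_pow_def J1_4_8_def point_group_def)
  have one: "\<one>\<^bsub>J1_4_8 K\<^esub> = Infinity" by (simp add: J1_4_8_def point_group_def)
  show ?thesis
    unfolding torsion_def[of "J1_4_8 K"] carrier_J1_4_8 pow one
    by (auto simp: torsion_def twist_def)
qed

lemma torsion_group_J1_4_8: "torsion_group (J1_4_8 K) = EC\<lparr>carrier := torsion (J1_4_8 K)\<rparr>"
  by (simp add: torsion_group_def J1_4_8_def point_group_def)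

lemma zeta_8: "zeta 8 = sqrt2 / 2 * (1 + \<i>)"
proof -
  have "zeta 8 = cis (pi / 4)" by (simp add: zeta_def)
  then show ?thesis by (simp add: complex_eq_iff cos_45 sin_45)
qed

lemma i_sqrt2_in_Qzeta8:
  shows "\<i> \<in> \<rat>({zeta 8})" "sqrt2 \<in> \<rat>({zeta 8})"
proof -
  interpret csubfield "\<rat>({zeta 8})" unfolding adjoin_rat_def by (rule csubfield_generate)
  have z: "zeta 8 \<in> \<rat>({zeta 8})" unfolding adjoin_rat_def by (rule generate_field.incl) simp
  have "\<i> = (zeta 8)\<^sup>2"
    by (simp add: zeta_8 power2_eq_square algebra_simps)
  then show i: "\<i> \<in> \<rat>({zeta 8})" using power[OF z, of 2] by simp
  have "sqrt2 = zeta 8 * (1 - \<i>)" by (simp add: zeta_8 algebra_simps)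
  then show "sqrt2 \<in> \<rat>({zeta 8})" using mult[OF z, of "1 - \<i>"] i by simp
qed

lemma Qzeta8_subset: "\<rat>({zeta 8}) \<subseteq> Qi_sqrt2"
proof -
  interpret csubfield Qi_sqrt2 by (rule csubfield_Qi_sqrt2)
  have "\<i> \<in> Qi_sqrt2"
    using csubfield.root_in_adj[OF csubfield_Rats] csubfield.subset_adj[OF csubfield_Qi] by blast
  moreover have "sqrt2 \<in> Qi_sqrt2" by (rule csubfield.root_in_adj[OF csubfield_Qi])
  ultimately have "zeta 8 \<in> Qi_sqrt2" by (simp add: zeta_8)
  then show ?thesis
    unfolding adjoin_rat_def by (intro generate_subset_csubfield csubfield_Qi_sqrt2) simp
qed

lemma Qi_generated: "\<rat>({\<i>}) \<subseteq> Qi"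
  unfolding adjoin_rat_def
  by (intro generate_subset_csubfield csubfield_Qi) (simp add: csubfield.root_in_adj[OF csubfield_Rats])

lemma (in csubfield) pt_A_twist: "\<i> \<in> L \<Longrightarrow> pt_A \<in> twist L 1"
  using pt_A_ell by (simp add: twist_def)

lemma (in csubfield) pt_B_twist: "sqrt2 \<in> L \<Longrightarrow> pt_B \<in> twist L 1"
  using pt_B_ell by (simp add: twist_def)

text \<open>The hypothesis \<open>no_sqrt2\<close> prevents \<open>R\<close> from being a half of
  \<open>(1, 0)\<close> or \<open>(-1, 0)\<close>; this is how the absence of a square root of 2 in
  the field enters. The remaining doubles, \<open>Infinity\<close> and \<open>(0, 0)\<close>, are
  doubles of \<open>Infinity\<close> and \<open>pt_A\<close>.\<close>

lemma four_torsion_spanned_Qi: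
  assumes "R \<in> ell" "(R \<boxplus> R) \<boxplus> (R \<boxplus> R) = Infinity"
    and no_sqrt2: "\<And>x y. R = Affine x y \<Longrightarrow> (x - 1)\<^sup>2 \<noteq> 2 \<and> (x + 1)\<^sup>2 \<noteq> 2"
  shows "R \<in> spanned (Affine 1 0) pt_A"
proof -
  note CA = two_torsion_ell(2) pt_A_ell
  note gens = spanned_gens[OF CA] and add = spanned_add[OF CA]
  have "Affine 0 0 \<in> spanned (Affine 1 0) pt_A"
    using add[OF gens(3) gens(3)] double_pt_A by simp
  note sub = two_torsion_spanned[OF CA this gens(2)]
  have "R \<boxplus> R \<in> {Infinity, Affine 0 0, Affine 1 0, Affine (-1) 0}"
    using two_torsion_cases[OF _ assms(2)] assms(1) by simp
  moreover have "R \<boxplus> R \<noteq> Affine 1 0 \<and> R \<boxplus> R \<noteq> Affine (-1) 0"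
  proof (cases R)
    case (Affine x y)
    then show ?thesis
      using halves_of_two_torsion(2)[of x y 1 0] halves_of_two_torsion(3)[of x y "-1" 0]
        no_sqrt2[OF Affine] assms(1) by auto
  qed simp
  ultimately have "R \<boxplus> R = Infinity \<or> R \<boxplus> R = Affine 0 0" by blast
  then obtain T where "T \<in> spanned (Affine 1 0) pt_A" "R \<boxplus> R = T \<boxplus> T"
    using gens double_pt_A by (metis point_add.simps(1))
  then show ?thesis using spanned_halves[OF CA assms(1) _ _ sub] by blast
qed

lemma pow_lt_4:
  assumes "P \<in> ell" "(P \<boxplus> P) \<boxplus> (P \<boxplus> P) = Infinity" "n < (4::nat)"
  shows "n = 0 \<and> P [^]\<^bsub>EC\<^esub> n = Infinity \<or> n = 1 \<and> P [^]\<^bsub>EC\<^esub> n = P \<or>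
    n = 2 \<and> P [^]\<^bsub>EC\<^esub> n = P \<boxplus> P \<or> n = 3 \<and> P [^]\<^bsub>EC\<^esub> n = \<boxminus> P"
proof -
  have "P [^]\<^bsub>EC\<^esub> (3::nat) \<boxplus> P = Infinity"
    using pow_2_4(2)[OF assms(1)] assms(2) EC.nat_pow_Suc[of P 3] by (simp add: numeral_eq_Suc)
  then have "P [^]\<^bsub>EC\<^esub> (3::nat) = \<boxminus> P" by (metis add_eq_Infinity_iff neg_neg)
  moreover have "n = 0 \<or> n = 1 \<or> n = 2 \<or> n = 3" using assms(3) by linarith
  ultimately show ?thesis using pow_2_4(1)[OF assms(1)] EC.nat_pow_eone[of P] assms(1) by auto
qed

lemma one_plus_sqrt2_neq: "1 + sqrt2 \<noteq> \<i>" "1 + sqrt2 \<noteq> 0"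
proof -
  have "1 + sqrt 2 \<noteq> 0" using real_sqrt_ge_zero[of 2] by linarith
  then have "Re (1 + sqrt2) \<noteq> Re \<i>" "Re (1 + sqrt2) \<noteq> Re 0" by simp_all
  then show "1 + sqrt2 \<noteq> \<i>" "1 + sqrt2 \<noteq> 0" by metis+
qed

lemma iso_Qi:
  "EC\<lparr>carrier := spanned (Affine 1 0) pt_A\<rparr> \<cong> integer_mod_group 2 \<times>\<times> integer_mod_group 4"
proof (rule EC.iso_two_generators[where c = "Affine 1 0" and a = pt_A])
  have A4: "(pt_A \<boxplus> pt_A) \<boxplus> (pt_A \<boxplus> pt_A) = Infinity"
    unfolding double_pt_A by (simp add: add_Affine)
  show "pt_A [^]\<^bsub>EC\<^esub> (4::nat) = \<one>\<^bsub>EC\<^esub>" using pow_2_4(2)[OF pt_A_ell] A4 by simp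
  show "Affine 1 0 [^]\<^bsub>EC\<^esub> (2::nat) = \<one>\<^bsub>EC\<^esub>"
    using pow_2_4(1)[OF two_torsion_ell(2)] by (simp add: add_Affine)
  show "m = 0 \<and> n = 0"
    if "m < 2" "n < 4" and eq: "Affine 1 0 [^]\<^bsub>EC\<^esub> m \<otimes>\<^bsub>EC\<^esub> pt_A [^]\<^bsub>EC\<^esub> n = \<one>\<^bsub>EC\<^esub>" for m n :: nat
  proof -
    have "m = 0 \<and> Affine 1 0 [^]\<^bsub>EC\<^esub> m = Infinity \<or> m = 1 \<and> Affine 1 0 [^]\<^bsub>EC\<^esub> m = Affine 1 0"
      using \<open>m < 2\<close> EC.nat_pow_eone[of "Affine 1 0"] two_torsion_ell(2) by (auto simp: less_2_cases_iff)
    moreover have "pt_A [^]\<^bsub>EC\<^esub> n = \<boxminus> (Affine 1 0 [^]\<^bsub>EC\<^esub> m)"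
      using eq by (simp add: add_eq_Infinity_iff)
    \<comment> \<open>The affine multiples of \<open>pt_A\<close> have abscissa \<open>\<i>\<close>
      or \<open>0\<close>, never \<open>1\<close>.\<close>
    ultimately show ?thesis
      using pow_lt_4[OF pt_A_ell A4 \<open>n < 4\<close>] unfolding double_pt_A by (auto simp: complex_eq_iff)
  qed
  show "spanned (Affine 1 0) pt_A =
      {Affine 1 0 [^]\<^bsub>EC\<^esub> m \<otimes>\<^bsub>EC\<^esub> pt_A [^]\<^bsub>EC\<^esub> n | (m::nat) (n::nat). True}"
    by (simp add: spanned_def)
qed (use pt_A_ell two_torsion_ell in simp_all)

lemma iso_Qi_sqrt2:
  "EC\<lparr>carrier := spanned pt_B pt_A\<rparr> \<cong> integer_mod_group 4 \<times>\<times> integer_mod_group 4"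
proof (rule EC.iso_two_generators[where c = pt_B and a = pt_A])
  have A4: "(pt_A \<boxplus> pt_A) \<boxplus> (pt_A \<boxplus> pt_A) = Infinity"
    unfolding double_pt_A by (simp add: add_Affine)
  have B4: "(pt_B \<boxplus> pt_B) \<boxplus> (pt_B \<boxplus> pt_B) = Infinity"
    unfolding double_pt_B by (simp add: add_Affine)
  show "pt_A [^]\<^bsub>EC\<^esub> (4::nat) = \<one>\<^bsub>EC\<^esub>" using pow_2_4(2)[OF pt_A_ell] A4 by simp
  show "pt_B [^]\<^bsub>EC\<^esub> (4::nat) = \<one>\<^bsub>EC\<^esub>" using pow_2_4(2)[OF pt_B_ell] B4 by simp
  show "m = 0 \<and> n = 0"
    if "m < 4" "n < 4" and eq: "pt_B [^]\<^bsub>EC\<^esub> m \<otimes>\<^bsub>EC\<^esub> pt_A [^]\<^bsub>EC\<^esub> n = \<one>\<^bsub>EC\<^esub>" for m n :: nat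
  proof -
    have "pt_A [^]\<^bsub>EC\<^esub> n = \<boxminus> (pt_B [^]\<^bsub>EC\<^esub> m)"
      using eq by (simp add: add_eq_Infinity_iff)
    \<comment> \<open>Abscissae alone separate the affine multiples: \<open>\<i>\<close> and
      \<open>0\<close> for \<open>pt_A\<close> against \<open>1 + sqrt2\<close> and \<open>1\<close>
      for \<open>pt_B\<close>.\<close>
    moreover have "\<i> \<noteq> 1 + sqrt2" "0 \<noteq> 1 + sqrt2" using one_plus_sqrt2_neq by metis+
    moreover have "\<i> \<noteq> 1" "\<i> \<noteq> 0" by (simp_all add: complex_eq_iff)
    ultimately show ?thesis
      using pow_lt_4[OF pt_A_ell A4 \<open>n < 4\<close>] pow_lt_4[OF pt_B_ell B4 \<open>m < 4\<close>]
      unfolding double_pt_A double_pt_B by auto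
  qed
  show "spanned pt_B pt_A =
      {pt_B [^]\<^bsub>EC\<^esub> m \<otimes>\<^bsub>EC\<^esub> pt_A [^]\<^bsub>EC\<^esub> n | (m::nat) (n::nat). True}"
    by (simp add: spanned_def)
qed (simp_all add: pt_A_ell pt_B_ell)

theorem theorem4p11:
  fixes K K8 :: "complex set"
  assumes "multi_quadratic_number_field K"
    and "\<rat>({\<i>}) \<subseteq> K"
  defines "K8 \<equiv> K \<inter> \<rat>({zeta 8})"
  shows "torsion (J1_4_8 K) = carrier (J1_4_8 K8)
    \<and> (K8 = \<rat>({\<i>}) \<longrightarrow>
         torsion_group (J1_4_8 K) \<cong> integer_mod_group 2 \<times>\<times> integer_mod_group 4)
    \<and> (K8 = \<rat>({\<i>, complex_of_real (sqrt 2)}) \<longrightarrow>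
         torsion_group (J1_4_8 K) \<cong> integer_mod_group 4 \<times>\<times> integer_mod_group 4)"
proof -
  interpret K: csubfield K by (rule csubfield_multi_quadratic[OF assms(1)])
  interpret Z: csubfield "\<rat>({zeta 8})" unfolding adjoin_rat_def by (rule csubfield_generate)
  interpret K8: csubfield K8 unfolding K8_def by unfold_locales auto
  have "\<i> \<in> \<rat>({\<i>})" unfolding adjoin_rat_def by (rule generate_field.incl) simp
  then have i: "\<i> \<in> K8" using assms(2) i_sqrt2_in_Qzeta8(1) by (auto simp: K8_def)
  have killed: "(P \<boxplus> P) \<boxplus> (P \<boxplus> P) = Infinity" if "P \<in> torsion (J1_4_8 K)" for P
    using multi_quadratic_torsion[OF assms(1)] that unfolding torsion_J1_4_8 by blast
  have spanned: "P \<in> spanned pt_B pt_A" if "P \<in> torsion (J1_4_8 K)" for P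
  proof -
    have "P \<in> ell" using that twist_in_ell unfolding torsion_J1_4_8 by blast
    then show ?thesis using four_torsion_spanned pow_2_4(2) killed[OF that] by simp
  qed
  have torsion_eq: "torsion (J1_4_8 K) = twist K8 1"
  proof (intro equalityI subsetI)
    fix P assume P: "P \<in> torsion (J1_4_8 K)"
    \<comment> \<open>Both generators of the 4-torsion have coordinates in Q(zeta_8), so torsion
      over \<open>K\<close> is defined over the intersection of the two fields.\<close>
    then have "P \<in> twist (\<rat>({zeta 8})) 1"
      using spanned[OF P] Z.spanned_subset_twist[OF Z.pt_B_twist Z.pt_A_twist] i_sqrt2_in_Qzeta8 by blast
    moreover have "P \<in> twist K 1" using P unfolding torsion_J1_4_8 by blast
    ultimately show "P \<in> twist K8 1" by (auto simp: twist_def K8_def)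
  next
    fix P assume P: "P \<in> twist K8 1"
    then have "P \<in> twist Qi_sqrt2 1" using Qzeta8_subset by (auto simp: twist_def K8_def)
    moreover have "P \<in> twist K 1" using P by (auto simp: twist_def K8_def)
    ultimately show "P \<in> torsion (J1_4_8 K)"
      unfolding torsion_J1_4_8 using twist_Qi_sqrt2_torsion by blast
  qed
  have case_Qi: "torsion_group (J1_4_8 K) \<cong> integer_mod_group 2 \<times>\<times> integer_mod_group 4"
    if K8_eq: "K8 = \<rat>({\<i>})"
  proof -
    have "torsion (J1_4_8 K) = spanned (Affine 1 0) pt_A"
    proof
      have "Affine 1 0 \<in> twist K8 1" using two_torsion_ell(2) by (simp add: twist_def)
      then show "spanned (Affine 1 0) pt_A \<subseteq> torsion (J1_4_8 K)"
        unfolding torsion_eq using K8.spanned_subset_twist K8.pt_A_twist[OF i] by blast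
      show "torsion (J1_4_8 K) \<subseteq> spanned (Affine 1 0) pt_A"
      proof
        fix P assume P: "P \<in> torsion (J1_4_8 K)"
        have P_twist: "P \<in> twist K8 1" using P torsion_eq by simp
        \<comment> \<open>A square root of 2 in \<open>K8\<close> would put \<open>sqrt2\<close>
          into \<open>Qi\<close>.\<close>
        have no_sqrt2: "z\<^sup>2 \<noteq> 2" if "z \<in> K8" for z
        proof
          assume "z\<^sup>2 = 2"
          then have "z = sqrt2 \<or> z = - sqrt2" by (metis power2_eq_iff sqrt2_squared(1))
          moreover have "- z \<in> K8" using that by simp
          ultimately have "sqrt2 \<in> K8" using that by (metis minus_minus)
          then show False using sqrt2_notin_Qi Qi_generated K8_eq by blast
        qed
        have "x \<in> K8" if "P = Affine x y" for x y using P_twist that by (auto simp: twist_def)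
        then show "P \<in> spanned (Affine 1 0) pt_A"
          using four_torsion_spanned_Qi[OF twist_in_ell[OF P_twist] killed[OF P]] no_sqrt2 by simp
      qed
    qed
    then show ?thesis unfolding torsion_group_J1_4_8 using iso_Qi by simp
  qed
  have case_Qi_sqrt2: "torsion_group (J1_4_8 K) \<cong> integer_mod_group 4 \<times>\<times> integer_mod_group 4"
    if K8_eq: "K8 = \<rat>({\<i>, sqrt2})"
  proof -
    have "sqrt2 \<in> K8" unfolding K8_eq adjoin_rat_def by (rule generate_field.incl) simp
    then have "spanned pt_B pt_A \<subseteq> torsion (J1_4_8 K)"
      unfolding torsion_eq using K8.spanned_subset_twist K8.pt_A_twist[OF i] K8.pt_B_twist by blast
    then have "torsion (J1_4_8 K) = spanned pt_B pt_A" using spanned by blast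
    then show ?thesis unfolding torsion_group_J1_4_8 using iso_Qi_sqrt2 by simp
  qed
  show ?thesis using torsion_eq carrier_J1_4_8 case_Qi case_Qi_sqrt2 by simp
qed

end
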